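(* Let $\mathcal{Q}$ be a small quantaloid and let $\mathbb{T}=(T,m,e)$, $\mathbb{S}=(S,n,d)$ be monads on $\mathbf{Set}/\mathcal{Q}_0$ with monotone distributive laws $\lambda$, $\kappa$ over $\mathbb{P}_{\mathcal{Q}}$ and corresponding lax extensions $\hat{T}$, $\hat{S}$ to $\mathcal{Q}\text{-}\mathbf{Rel}$, respectively. Every algebraic morphism $h\colon(\mathbb{T},\hat{T})\to(\mathbb{S},\hat{S})$ of lax extensions induces a functor (the algebraic functor) $$A_h\colon(\mathbb{T},\hat{T},\mathcal{Q})\text{-}\mathbf{Cat}\to(\mathbb{S},\hat{S},\mathcal{Q})\text{-}\mathbf{Cat},\quad(X,\alpha)\mapsto(X,h_X\circ\alpha).$$ When $h$ is equivalently described as an algebraic morphism $\tau\colon\kappa\to\lambda$ of monotone distributive laws, $\tau_X=\overleftarrow{h_X}$, then $A_h$ is equivalently described (under the isomorphisms $(X,\alpha)\mapsto(X,\overleftarrow{\alpha})$ of $(\mathbb{T},\hat{T},\mathcal{Q})\text{-}\mathbf{Cat}$ with $(\lambda,\mathcal{Q})\text{-}\mathbf{Alg}$ and of $(\mathbb{S},\hat{S},\mathcal{Q})\text{-}\mathbf{Cat}$ with $(\kappa,\mathcal{Q})\text{-}\mathbf{Alg}$) as the algebraic functor $$A_\tau\colon(\lambda,\mathcal{Q})\text{-}\mathbf{Alg}\to(\kappa,\mathcal{Q})\text{-}\mathbf{Alg},\quad(X,p)\mapsto(X,\mathsf{s}_X\cdot p_!\cdot\tau_X).$$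
   Context: A quantaloid is a category whose hom-sets are complete lattices and whose composition preserves arbitrary suprema in each variable. $\mathcal{Q}$ is a small quantaloid with object set $\mathcal{Q}_0$; $\bot$ denotes bottom elements. Objects of $\mathbf{Set}/\mathcal{Q}_0$ are sets $X$ with an array map $|\cdot|_X\colon X\to\mathcal{Q}_0$; morphisms are array-preserving maps. $\mathcal{Q}\text{-}\mathbf{Rel}$ has the same objects; a $\mathcal{Q}$-relation $\varphi\colon X\nrightarrow Y$ is a family of $\mathcal{Q}$-morphisms $\varphi(x,y)\colon|x|\to|y|$, with $(\psi\circ\varphi)(x,z)=\bigvee_{y}\psi(y,z)\circ\varphi(x,y)$; hom-sets are ordered pointwise. For $f\colon X\to Y$ in $\mathbf{Set}/\mathcal{Q}_0$, $f^\circ\colon Y\nrightarrow X$ is $f^\circ(y,x)=1_{|x|}$ if $f(x)=y$ and $\bot$ otherwise; $1_X^\circ$ is the identity $\mathcal{Q}$-relation. Discrete presheaf monad $\mathbb{P}_{\mathcal{Q}}=(\mathsf{P},\mathsf{s},\mathsf{y})$: $\mathsf{P}X$ is the set of all families $\sigma=(\sigma_x\colon|x|\to s)_{x\in X}$ of $\mathcal{Q}$-morphisms with a specified common codomain $s=:|\sigma|$ (the array of $\sigma$), ordered by $\sigma\le\sigma'$ iff $|\sigma|=|\sigma'|$ and $\sigma_x\le\sigma'_x$ for all $x$; maps into $\mathsf{P}X$ are ordered pointwise. $\mathsf{P}f=f_!$, $(f_!\sigma)_y=\bigvee_{x\in f^{-1}y}\sigma_x$; $(\mathsf{y}_Xy)_x=1_{|y|}$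 if $x=y$, else $\bot$; $(\mathsf{s}_X\Sigma)_x=\bigvee_{\sigma}\Sigma_\sigma\circ\sigma_x$. For $\varphi\colon X\nrightarrow Y$, $\overleftarrow{\varphi}\colon Y\to\mathsf{P}X$ is $(\overleftarrow{\varphi}(y))_x=\varphi(x,y)$. $\varepsilon_X\colon X\nrightarrow\mathsf{P}X$ is $\varepsilon_X(x,\sigma)=\sigma_x$. A monotone distributive law of $\mathbb{T}$ over $\mathbb{P}_{\mathcal{Q}}$ is a family of morphisms $\lambda_X\colon T\mathsf{P}X\to\mathsf{P}TX$ in $\mathbf{Set}/\mathcal{Q}_0$ such that for all $X$ and $f\colon X\to Y$: $(Tf)_!\cdot\lambda_X\le\lambda_Y\cdot T(f_!)$; $\mathsf{y}_{TX}\le\lambda_X\cdot T\mathsf{y}_X$; $\mathsf{s}_{TX}\cdot(\lambda_X)_!\cdot\lambda_{\mathsf{P}X}\le\lambda_X\cdot T\mathsf{s}_X$; $(e_X)_!\le\lambda_X\cdot e_{\mathsf{P}X}$; $(m_X)_!\cdot\lambda_{TX}\cdot T\lambda_X\le\lambda_X\cdot m_{\mathsf{P}X}$; and $f\le g\Rightarrow\lambda_X\cdot Tf\le\lambda_X\cdot Tg$ for all $f,g\colon Y\to\mathsf{P}X$. A lax extension $\hat{T}$ of $\mathbb{T}$ to $\mathcal{Q}\text{-}\mathbf{Rel}$ is a family of $\mathcal{Q}$-relations $\hat{T}\varphi\colon TX\nrightarrow TY$ $(\varphi\colon X\nrightarrow Y)$, monotone in $\varphi$, with $\hat{T}(h^\circ\circ\varphi)=(Th)^\circ\circ\hat{T}\varphi$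 ($h\colon Z\to Y$), $1_{TX}^\circ\le\hat{T}(1_X^\circ)$, $\hat{T}\psi\circ\hat{T}\varphi\le\hat{T}(\psi\circ\varphi)$, $\varphi\circ e_X^\circ\le e_Y^\circ\circ\hat{T}\varphi$, $\hat{T}\hat{T}\varphi\circ m_X^\circ\le m_Y^\circ\circ\hat{T}\varphi$. Monotone distributive laws and lax extensions correspond bijectively via $\overleftarrow{\hat{T}\varphi}=\lambda_X\cdot T\overleftarrow{\varphi}$, $\lambda_X=\overleftarrow{\hat{T}\varepsilon_X}$. $(\lambda,\mathcal{Q})\text{-}\mathbf{Alg}$: objects $(X,p)$ with $p\colon TX\to\mathsf{P}X$ in $\mathbf{Set}/\mathcal{Q}_0$, $\mathsf{y}_X\le p\cdot e_X$, $\mathsf{s}_X\cdot p_!\cdot\lambda_X\cdot Tp\le p\cdot m_X$; morphisms $f\colon(X,p)\to(Y,q)$ in $\mathbf{Set}/\mathcal{Q}_0$ with $f_!\cdot p\le q\cdot Tf$. $(\mathbb{T},\hat{T},\mathcal{Q})\text{-}\mathbf{Cat}$: objects $(X,\alpha)$ with $\alpha\colon X\nrightarrow TX$, $1_X^\circ\le e_X^\circ\circ\alpha$, $\hat{T}\alpha\circ\alpha\le m_X^\circ\circ\alpha$; morphisms $f\colon(X,\alpha)\to(Y,\beta)$ in $\mathbf{Set}/\mathcal{Q}_0$ with $\alpha\circ f^\circ\le(Tf)^\circ\circ\beta$. Both functors in the claim leave the underlying maps of morphisms unchanged. An algebraic morphism $h\colon(\mathbb{T},\hat{T})\to(\mathbb{S},\hat{S})$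 is a family of $\mathcal{Q}$-relations $h_X\colon TX\nrightarrow SX$ such that for all $f\colon X\to Y$ in $\mathbf{Set}/\mathcal{Q}_0$, $\varphi\colon X\nrightarrow Y$, $\alpha\colon X\nrightarrow TX$: (a) $h_X\circ(Tf)^\circ\le(Sf)^\circ\circ h_Y$; (b) $e_X^\circ\le d_X^\circ\circ h_X$; (c) $\hat{S}h_X\circ h_{TX}\circ m_X^\circ\le n_X^\circ\circ h_X$; (d) $\hat{S}\varphi\circ h_X\le h_Y\circ\hat{T}\varphi$; (e) $\hat{S}(h_X\circ\alpha)\le\hat{S}h_X\circ\hat{S}\alpha$. Equivalently, with $\tau_X=\overleftarrow{h_X}$, an algebraic morphism $\tau\colon\kappa\to\lambda$ is a family of $\mathbf{Set}/\mathcal{Q}_0$-morphisms $\tau_X\colon SX\to\mathsf{P}TX$ such that for all $f\colon X\to Y$, $g\colon Y\to\mathsf{P}X$, $p\colon TX\to\mathsf{P}X$ in $\mathbf{Set}/\mathcal{Q}_0$: (a') $(Tf)_!\cdot\tau_X\le\tau_Y\cdot Sf$; (b') $\mathsf{y}_{TX}\cdot e_X\le\tau_X\cdot d_X$; (c') $(m_X)_!\cdot\mathsf{s}_{TTX}\cdot(\tau_{TX})_!\cdot\kappa_{TX}\cdot S\tau_X\le\tau_X\cdot n_X$; (d') $\mathsf{s}_{TX}\cdot(\tau_X)_!\cdot\kappa_X\cdot Sg\le\mathsf{s}_{TX}\cdot(\lambda_X)_!\cdot(Tg)_!\cdot\tau_Y$; (e') $\kappa_X\cdot S\mathsf{s}_X\cdot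 S(p_!)\cdot S\tau_X\le\mathsf{s}_{SX}\cdot(\kappa_X)_!\cdot(Sp)_!\cdot\kappa_{TX}\cdot S\tau_X$. *)

theory Defs
  imports "HOL-Algebra.Complete_Lattice" "HOL-Library.FuncSet"
begin

section \<open>Sets\<close>

text \<open>
  The category \<open>Set\<close> is rendered as the category of small sets of a set-theoretic universe.
  HOL cannot quantify over all sets as a category on which a monad acts, because the carrier of
  \<open>P X\<close> would live in a new type. We therefore work over an arbitrary type
  whose elements are the sets of a (Grothendieck) universe, \<open>elts x\<close> being the extension of
  \<open>x\<close>. A HOL set of such elements is small if it is the extension of some element.
  An infinity axiom is not required, so that the universe of all
  sets is covered as well as, e.g., that of hereditarily finite sets.
\<close>

class universe =
  fixes elts :: "'a \<Rightarrow> 'a set"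
  assumes extensionality: "elts x = elts y \<Longrightarrow> x = y"
    and separation: "B \<subseteq> elts x \<Longrightarrow> B \<in> range elts"
    and pairing: "{x, y} \<in> range elts"
    and union: "(\<Union>y\<in>elts x. elts y) \<in> range elts"
    and power_set: "{y. elts y \<subseteq> elts x} \<in> range elts"
    and replacement: "f ` elts x \<in> range elts"

definition small :: "'u::universe set \<Rightarrow> bool" where
  "small A \<longleftrightarrow> A \<in> range elts"

definition mkset :: "'u::universe set \<Rightarrow> 'u" where
  "mkset A = (THE x. elts x = A)"

definition kpair :: "'u::universe \<Rightarrow> 'u \<Rightarrow> 'u" where
  "kpair a b = mkset {mkset {a}, mkset {a, b}}"

lemma elts_mkset: "small A \<Longrightarrow> elts (mkset A) = A"
  unfolding small_def mkset_def by (rule theI') (auto intro: extensionality)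

lemma kpair_inject [simp]: "kpair a b = kpair c d \<longleftrightarrow> a = c \<and> b = d"
proof
  assume eq: "kpair a b = kpair c d"
  have sm: "small {x, y}" for x y :: 'a by (simp add: small_def pairing)
  have inj: "mkset A = mkset B \<Longrightarrow> A = B" if "small A" "small B" for A B :: "'a set"
    using that elts_mkset by metis
  have sm1: "small {x}" for x :: 'a using sm[of x x] by simp
  have "{mkset {a}, mkset {a, b}} = {mkset {c}, mkset {c, d}}"
    using eq unfolding kpair_def by (rule inj[OF sm sm])
  then show "a = c \<and> b = d"
    unfolding doubleton_eq_iff
    using inj[OF sm1 sm1] inj[OF sm sm] inj[OF sm1 sm] inj[OF sm sm1]
    by (metis doubleton_eq_iff insert_absorb2)
qed simp


section \<open>Categories and functors\<close>

text \<open>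
  Hom-sets are indexed by their end points and need not be disjoint; accordingly the arrow part
  of a functor is indexed by the end points as well.
\<close>

record ('o, 'm) category =
  Ob :: "'o set"
  Hom :: "'o \<Rightarrow> 'o \<Rightarrow> 'm set"
  Comp :: "'m \<Rightarrow> 'm \<Rightarrow> 'm"
  Ide :: "'o \<Rightarrow> 'm"

definition is_category :: "('o, 'm, 'z) category_scheme \<Rightarrow> bool" where
  "is_category C \<longleftrightarrow>
     (\<forall>a\<in>Ob C. Ide C a \<in> Hom C a a) \<and>
     (\<forall>a\<in>Ob C. \<forall>b\<in>Ob C. \<forall>c\<in>Ob C. \<forall>f\<in>Hom C a b. \<forall>g\<in>Hom C b c. Comp C g f \<in> Hom C a c) \<and>
     (\<forall>a\<in>Ob C. \<forall>b\<in>Ob C. \<forall>f\<in>Hom C a b. Comp C f (Ide C a) = f \<and> Comp C (Ide C b) f = f) \<and>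
     (\<forall>a\<in>Ob C. \<forall>b\<in>Ob C. \<forall>c\<in>Ob C. \<forall>d\<in>Ob C.
        \<forall>f\<in>Hom C a b. \<forall>g\<in>Hom C b c. \<forall>h\<in>Hom C c d.
          Comp C h (Comp C g f) = Comp C (Comp C h g) f)"

record ('o, 'm, 'p, 'n) functor_data =
  fob :: "'o \<Rightarrow> 'p"
  farr :: "'o \<Rightarrow> 'o \<Rightarrow> 'm \<Rightarrow> 'n"

definition is_functor ::
  "('o, 'm, 'y) category_scheme \<Rightarrow> ('p, 'n, 'z) category_scheme
    \<Rightarrow> ('o, 'm, 'p, 'n, 'w) functor_data_scheme \<Rightarrow> bool" where
  "is_functor C D F \<longleftrightarrow> is_category C \<and> is_category D \<and>
     (\<forall>a\<in>Ob C. fob F a \<in> Ob D) \<and>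
     (\<forall>a\<in>Ob C. \<forall>b\<in>Ob C. \<forall>f\<in>Hom C a b. farr F a b f \<in> Hom D (fob F a) (fob F b)) \<and>
     (\<forall>a\<in>Ob C. farr F a a (Ide C a) = Ide D (fob F a)) \<and>
     (\<forall>a\<in>Ob C. \<forall>b\<in>Ob C. \<forall>c\<in>Ob C. \<forall>f\<in>Hom C a b. \<forall>g\<in>Hom C b c.
        farr F a c (Comp C g f) = Comp D (farr F b c g) (farr F a b f))"

definition functor_id :: "('o, 'm, 'o, 'm) functor_data" where
  "functor_id = \<lparr>fob = (\<lambda>a. a), farr = (\<lambda>a b f. f)\<rparr>"

definition functor_comp ::
  "('p, 'n, 'q, 'l) functor_data \<Rightarrow> ('o, 'm, 'p, 'n) functor_data
    \<Rightarrow> ('o, 'm, 'q, 'l) functor_data" where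
  "functor_comp G F =
     \<lparr>fob = (\<lambda>a. fob G (fob F a)),
      farr = (\<lambda>a b f. farr G (fob F a) (fob F b) (farr F a b f))\<rparr>"

definition functors_equal ::
  "('o, 'm, 'z) category_scheme \<Rightarrow> ('o, 'm, 'p, 'n) functor_data
    \<Rightarrow> ('o, 'm, 'p, 'n) functor_data \<Rightarrow> bool" where
  "functors_equal C F G \<longleftrightarrow>
     (\<forall>a\<in>Ob C. fob F a = fob G a) \<and>
     (\<forall>a\<in>Ob C. \<forall>b\<in>Ob C. \<forall>f\<in>Hom C a b. farr F a b f = farr G a b f)"

definition is_iso_functor ::
  "('o, 'm, 'y) category_scheme \<Rightarrow> ('p, 'n, 'z) category_scheme
    \<Rightarrow> ('o, 'm, 'p, 'n) functor_data \<Rightarrow> bool" where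
  "is_iso_functor C D F \<longleftrightarrow> is_functor C D F \<and>
     (\<exists>G. is_functor D C G \<and>
       functors_equal C (functor_comp G F) functor_id \<and>
       functors_equal D (functor_comp F G) functor_id)"


section \<open>Small quantaloids\<close>

record ('o, 'a) quantaloid = "('o, 'a) category" +
  leq :: "'a \<Rightarrow> 'a \<Rightarrow> bool"

definition Homl :: "('o, 'a, 'z) quantaloid_scheme \<Rightarrow> 'o \<Rightarrow> 'o \<Rightarrow> 'a gorder" where
  "Homl Q a b = \<lparr>carrier = Hom Q a b, eq = (=), le = leq Q\<rparr>"

definition small_quantaloid :: "('u::universe, 'u) quantaloid \<Rightarrow> bool" where
  "small_quantaloid Q \<longleftrightarrow> is_category Q \<and>
     small (Ob Q) \<and> (\<forall>a\<in>Ob Q. \<forall>b\<in>Ob Q. small (Hom Q a b)) \<and>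
     (\<forall>a\<in>Ob Q. \<forall>b\<in>Ob Q. complete_lattice (Homl Q a b)) \<and>
     (\<forall>a\<in>Ob Q. \<forall>b\<in>Ob Q. \<forall>c\<in>Ob Q. \<forall>v\<in>Hom Q b c. \<forall>A\<subseteq>Hom Q a b.
        Comp Q v (\<Squnion>\<^bsub>Homl Q a b\<^esub> A) = \<Squnion>\<^bsub>Homl Q a c\<^esub> (Comp Q v ` A)) \<and>
     (\<forall>a\<in>Ob Q. \<forall>b\<in>Ob Q. \<forall>c\<in>Ob Q. \<forall>u\<in>Hom Q a b. \<forall>A\<subseteq>Hom Q b c.
        Comp Q (\<Squnion>\<^bsub>Homl Q b c\<^esub> A) u = \<Squnion>\<^bsub>Homl Q a c\<^esub> ((\<lambda>v. Comp Q v u) ` A))"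


section \<open>The category of sets over the objects of a quantaloid\<close>

text \<open>
  Functions are extensional (\<open>undefined\<close> outside their domain), so that HOL equality of objects,
  maps and relations is the intended one.
\<close>

record 'u slice_ob =
  pts :: "'u set"
  arr :: "'u \<Rightarrow> 'u"

record 'u slice_map =
  src :: "'u slice_ob"
  trg :: "'u slice_ob"
  app :: "'u \<Rightarrow> 'u"

definition slice_obs :: "('u::universe, 'u) quantaloid \<Rightarrow> 'u slice_ob set" where
  "slice_obs Q = {X. small (pts X) \<and> arr X \<in> pts X \<rightarrow>\<^sub>E Ob Q}"

definition slice_maps :: "'u slice_ob \<Rightarrow> 'u slice_ob \<Rightarrow> 'u slice_map set" where
  "slice_maps X Y = {f. src f = X \<and> trg f = Y \<and> app f \<in> pts X \<rightarrow>\<^sub>E pts Y \<and>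
                        (\<forall>x\<in>pts X. arr Y (app f x) = arr X x)}"

definition map_comp :: "'u slice_map \<Rightarrow> 'u slice_map \<Rightarrow> 'u slice_map" (infixr "\<cdot>" 75) where
  "g \<cdot> f = \<lparr>src = src f, trg = trg g, app = (\<lambda>x\<in>pts (src f). app g (app f x))\<rparr>"

definition map_id :: "'u slice_ob \<Rightarrow> 'u slice_map" where
  "map_id X = \<lparr>src = X, trg = X, app = (\<lambda>x\<in>pts X. x)\<rparr>"

definition slice :: "('u::universe, 'u) quantaloid \<Rightarrow> ('u slice_ob, 'u slice_map) category" where
  "slice Q = \<lparr>Ob = slice_obs Q, Hom = slice_maps, Comp = (\<cdot>), Ide = map_id\<rparr>"

record 'u slice_monad = "('u slice_ob, 'u slice_map, 'u slice_ob, 'u slice_map) functor_data" +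
  mult :: "'u slice_ob \<Rightarrow> 'u slice_map"
  eta :: "'u slice_ob \<Rightarrow> 'u slice_map"

definition fmap :: "'u slice_monad \<Rightarrow> 'u slice_map \<Rightarrow> 'u slice_map" where
  "fmap T f = farr T (src f) (trg f) f"

definition is_monad :: "('u::universe, 'u) quantaloid \<Rightarrow> 'u slice_monad \<Rightarrow> bool" where
  "is_monad Q T \<longleftrightarrow> is_functor (slice Q) (slice Q) T \<and>
     (\<forall>X\<in>slice_obs Q. eta T X \<in> slice_maps X (fob T X)) \<and>
     (\<forall>X\<in>slice_obs Q. mult T X \<in> slice_maps (fob T (fob T X)) (fob T X)) \<and>
     (\<forall>X\<in>slice_obs Q. \<forall>Y\<in>slice_obs Q. \<forall>f\<in>slice_maps X Y.
        fmap T f \<cdot> eta T X = eta T Y \<cdot> f \<and>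
        fmap T f \<cdot> mult T X = mult T Y \<cdot> fmap T (fmap T f)) \<and>
     (\<forall>X\<in>slice_obs Q.
        mult T X \<cdot> eta T (fob T X) = map_id (fob T X) \<and>
        mult T X \<cdot> fmap T (eta T X) = map_id (fob T X) \<and>
        mult T X \<cdot> mult T (fob T X) = mult T X \<cdot> fmap T (mult T X))"


section \<open>Relations valued in a quantaloid\<close>

record 'u qrel =
  rsrc :: "'u slice_ob"
  rtrg :: "'u slice_ob"
  rval :: "'u \<Rightarrow> 'u \<Rightarrow> 'u"

definition qrels ::
  "('u::universe, 'u) quantaloid \<Rightarrow> 'u slice_ob \<Rightarrow> 'u slice_ob \<Rightarrow> 'u qrel set" where
  "qrels Q X Y = {\<phi>. rsrc \<phi> = X \<and> rtrg \<phi> = Y \<and>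
     rval \<phi> \<in> (\<Pi>\<^sub>E x\<in>pts X. \<Pi>\<^sub>E y\<in>pts Y. Hom Q (arr X x) (arr Y y))}"

definition qrel_comp ::
  "'u qrel \<Rightarrow> ('u::universe, 'u) quantaloid \<Rightarrow> 'u qrel \<Rightarrow> 'u qrel"
  ("(_/ \<odot>\<^bsub>_\<^esub> _)" [76, 0, 75] 75) where
  "\<psi> \<odot>\<^bsub>Q\<^esub> \<phi> = \<lparr>rsrc = rsrc \<phi>, rtrg = rtrg \<psi>,
     rval = (\<lambda>x\<in>pts (rsrc \<phi>). \<lambda>z\<in>pts (rtrg \<psi>).
       \<Squnion>\<^bsub>Homl Q (arr (rsrc \<phi>) x) (arr (rtrg \<psi>) z)\<^esub>
         ((\<lambda>y. Comp Q (rval \<psi> y z) (rval \<phi> x y)) ` pts (rtrg \<phi>)))\<rparr>"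

definition qrel_le ::
  "'u qrel \<Rightarrow> ('u::universe, 'u) quantaloid \<Rightarrow> 'u qrel \<Rightarrow> bool"
  ("(_/ \<preceq>\<^bsub>_\<^esub> _)" [51, 0, 51] 50) where
  "\<phi> \<preceq>\<^bsub>Q\<^esub> \<psi> \<longleftrightarrow> rsrc \<phi> = rsrc \<psi> \<and> rtrg \<phi> = rtrg \<psi> \<and>
     (\<forall>x\<in>pts (rsrc \<phi>). \<forall>y\<in>pts (rtrg \<phi>).
        rval \<phi> x y \<sqsubseteq>\<^bsub>Homl Q (arr (rsrc \<phi>) x) (arr (rtrg \<phi>) y)\<^esub> rval \<psi> x y)"

text \<open>\<open>cograph Q f\<close> is \<open>f\<^sup>\<circ> : Y \<rightarrow> X\<close> for \<open>f : X \<rightarrow> Y\<close>.\<close>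

definition cograph :: "('u::universe, 'u) quantaloid \<Rightarrow> 'u slice_map \<Rightarrow> 'u qrel" where
  "cograph Q f = \<lparr>rsrc = trg f, rtrg = src f,
     rval = (\<lambda>y\<in>pts (trg f). \<lambda>x\<in>pts (src f).
       if app f x = y then Ide Q (arr (src f) x)
       else \<bottom>\<^bsub>Homl Q (arr (trg f) y) (arr (src f) x)\<^esub>)\<rparr>"


section \<open>The discrete presheaf monad\<close>

text \<open>
  A family \<open>\<sigma>\<close> on \<open>X\<close> with codomain \<open>s\<close> is coded as the pair of \<open>s\<close> and the graph of \<open>\<sigma>\<close>;
  \<open>fam_cod\<close> and \<open>fam_at\<close> are the decoding functions. \<open>Pob\<close>, \<open>Pmap\<close> (\<open>f\<^sub>!\<close>), \<open>psup\<close> and \<open>yon\<close> are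
  the functor, multiplication and unit of the monad; \<open>mate Q \<phi> : Y \<rightarrow> P X\<close> is the transpose of the
  relation \<open>\<phi>\<close> from \<open>X\<close> to \<open>Y\<close>.
\<close>

definition fam :: "'u slice_ob \<Rightarrow> 'u \<Rightarrow> ('u \<Rightarrow> 'u) \<Rightarrow> 'u::universe" where
  "fam X s u = kpair s (mkset ((\<lambda>x. kpair x (u x)) ` pts X))"

definition fam_cod :: "'u::universe \<Rightarrow> 'u" where
  "fam_cod \<sigma> = (THE s. \<exists>g. \<sigma> = kpair s g)"

definition fam_at :: "'u::universe \<Rightarrow> 'u \<Rightarrow> 'u" where
  "fam_at \<sigma> x = (THE v. \<exists>s g. \<sigma> = kpair s g \<and> kpair x v \<in> elts g)"

lemma small_image: "small A \<Longrightarrow> small (f ` A)" for f :: "'u::universe \<Rightarrow> 'u"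
  unfolding small_def by (auto intro: replacement)

lemma fam_cod_fam [simp]: "fam_cod (fam X s u) = s"
  unfolding fam_cod_def fam_def by simp

lemma fam_at_fam [simp]: "small (pts X) \<Longrightarrow> x \<in> pts X \<Longrightarrow> fam_at (fam X s u) x = u x"
proof -
  assume "small (pts X)" "x \<in> pts X"
  then have "(\<exists>s' g. fam X s u = kpair s' g \<and> kpair x v \<in> elts g) \<longleftrightarrow> v = u x" for v
    unfolding fam_def by (simp add: elts_mkset small_image image_iff)
  then show "fam_at (fam X s u) x = u x"
    unfolding fam_at_def by simp
qed

definition Pob :: "('u::universe, 'u) quantaloid \<Rightarrow> 'u slice_ob \<Rightarrow> 'u slice_ob" where
  "Pob Q X =
     (let F = {fam X s u | s u. s \<in> Ob Q \<and> (\<forall>x\<in>pts X. u x \<in> Hom Q (arr X x) s)}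
      in \<lparr>pts = F, arr = (\<lambda>\<sigma>\<in>F. fam_cod \<sigma>)\<rparr>)"

definition fam_le ::
  "('u::universe, 'u) quantaloid \<Rightarrow> 'u slice_ob \<Rightarrow> 'u \<Rightarrow> 'u \<Rightarrow> bool" where
  "fam_le Q X \<sigma> \<sigma>' \<longleftrightarrow> fam_cod \<sigma> = fam_cod \<sigma>' \<and>
     (\<forall>x\<in>pts X. fam_at \<sigma> x \<sqsubseteq>\<^bsub>Homl Q (arr X x) (fam_cod \<sigma>)\<^esub> fam_at \<sigma>' x)"

text \<open>\<open>f \<lesssim>\<^bsub>Q,X\<^esub> g\<close> is the pointwise order of maps \<open>f, g : Y \<rightarrow> P X\<close>.\<close>

definition map_le ::
  "'u slice_map \<Rightarrow> ('u::universe, 'u) quantaloid \<Rightarrow> 'u slice_ob \<Rightarrow> 'u slice_map \<Rightarrow> bool"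
  ("(_/ \<lesssim>\<^bsub>_,_\<^esub> _)" [51, 0, 0, 51] 50) where
  "f \<lesssim>\<^bsub>Q,X\<^esub> g \<longleftrightarrow> src f = src g \<and> trg f = trg g \<and>
     (\<forall>y\<in>pts (src f). fam_le Q X (app f y) (app g y))"

definition Pmap :: "('u::universe, 'u) quantaloid \<Rightarrow> 'u slice_map \<Rightarrow> 'u slice_map" where
  "Pmap Q f = \<lparr>src = Pob Q (src f), trg = Pob Q (trg f),
     app = (\<lambda>\<sigma>\<in>pts (Pob Q (src f)). fam (trg f) (fam_cod \<sigma>)
       (\<lambda>y. \<Squnion>\<^bsub>Homl Q (arr (trg f) y) (fam_cod \<sigma>)\<^esub>
              (fam_at \<sigma> ` {x \<in> pts (src f). app f x = y})))\<rparr>"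

definition yon :: "('u::universe, 'u) quantaloid \<Rightarrow> 'u slice_ob \<Rightarrow> 'u slice_map" where
  "yon Q X = \<lparr>src = X, trg = Pob Q X,
     app = (\<lambda>y\<in>pts X. fam X (arr X y)
       (\<lambda>x. if x = y then Ide Q (arr X y) else \<bottom>\<^bsub>Homl Q (arr X x) (arr X y)\<^esub>))\<rparr>"

definition psup :: "('u::universe, 'u) quantaloid \<Rightarrow> 'u slice_ob \<Rightarrow> 'u slice_map" where
  "psup Q X = \<lparr>src = Pob Q (Pob Q X), trg = Pob Q X,
     app = (\<lambda>\<Sigma>\<in>pts (Pob Q (Pob Q X)). fam X (fam_cod \<Sigma>)
       (\<lambda>x. \<Squnion>\<^bsub>Homl Q (arr X x) (fam_cod \<Sigma>)\<^esub>
              ((\<lambda>\<sigma>. Comp Q (fam_at \<Sigma> \<sigma>) (fam_at \<sigma> x)) ` pts (Pob Q X))))\<rparr>"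

definition mate :: "('u::universe, 'u) quantaloid \<Rightarrow> 'u qrel \<Rightarrow> 'u slice_map" where
  "mate Q \<phi> = \<lparr>src = rtrg \<phi>, trg = Pob Q (rsrc \<phi>),
     app = (\<lambda>y\<in>pts (rtrg \<phi>). fam (rsrc \<phi>) (arr (rtrg \<phi>) y) (\<lambda>x. rval \<phi> x y))\<rparr>"

definition eps :: "('u::universe, 'u) quantaloid \<Rightarrow> 'u slice_ob \<Rightarrow> 'u qrel" where
  "eps Q X = \<lparr>rsrc = X, rtrg = Pob Q X,
     rval = (\<lambda>x\<in>pts X. \<lambda>\<sigma>\<in>pts (Pob Q X). fam_at \<sigma> x)\<rparr>"


section \<open>Monotone distributive laws and lax extensions\<close>

definition monotone_distributive_law ::
  "('u::universe, 'u) quantaloid \<Rightarrow> 'u slice_monad \<Rightarrow> ('u slice_ob \<Rightarrow> 'u slice_map) \<Rightarrow> bool"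
  where
  "monotone_distributive_law Q T lam \<longleftrightarrow>
     (\<forall>X\<in>slice_obs Q. lam X \<in> slice_maps (fob T (Pob Q X)) (Pob Q (fob T X))) \<and>
     (\<forall>X\<in>slice_obs Q. \<forall>Y\<in>slice_obs Q. \<forall>f\<in>slice_maps X Y.
        Pmap Q (fmap T f) \<cdot> lam X \<lesssim>\<^bsub>Q,fob T Y\<^esub> lam Y \<cdot> fmap T (Pmap Q f)) \<and>
     (\<forall>X\<in>slice_obs Q.
        yon Q (fob T X) \<lesssim>\<^bsub>Q,fob T X\<^esub> lam X \<cdot> fmap T (yon Q X) \<and>
        psup Q (fob T X) \<cdot> Pmap Q (lam X) \<cdot> lam (Pob Q X)
          \<lesssim>\<^bsub>Q,fob T X\<^esub> lam X \<cdot> fmap T (psup Q X) \<and>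
        Pmap Q (eta T X) \<lesssim>\<^bsub>Q,fob T X\<^esub> lam X \<cdot> eta T (Pob Q X) \<and>
        Pmap Q (mult T X) \<cdot> lam (fob T X) \<cdot> fmap T (lam X)
          \<lesssim>\<^bsub>Q,fob T X\<^esub> lam X \<cdot> mult T (Pob Q X)) \<and>
     (\<forall>X\<in>slice_obs Q. \<forall>Y\<in>slice_obs Q.
        \<forall>f\<in>slice_maps Y (Pob Q X). \<forall>g\<in>slice_maps Y (Pob Q X).
          f \<lesssim>\<^bsub>Q,X\<^esub> g \<longrightarrow> lam X \<cdot> fmap T f \<lesssim>\<^bsub>Q,fob T X\<^esub> lam X \<cdot> fmap T g)"

definition lax_extension ::
  "('u::universe, 'u) quantaloid \<Rightarrow> 'u slice_monad \<Rightarrow> ('u qrel \<Rightarrow> 'u qrel) \<Rightarrow> bool" where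
  "lax_extension Q T T' \<longleftrightarrow>
     (\<forall>X\<in>slice_obs Q. \<forall>Y\<in>slice_obs Q. \<forall>\<phi>\<in>qrels Q X Y. T' \<phi> \<in> qrels Q (fob T X) (fob T Y)) \<and>
     (\<forall>X\<in>slice_obs Q. \<forall>Y\<in>slice_obs Q. \<forall>\<phi>\<in>qrels Q X Y. \<forall>\<psi>\<in>qrels Q X Y.
        \<phi> \<preceq>\<^bsub>Q\<^esub> \<psi> \<longrightarrow> T' \<phi> \<preceq>\<^bsub>Q\<^esub> T' \<psi>) \<and>
     (\<forall>X\<in>slice_obs Q. \<forall>Y\<in>slice_obs Q. \<forall>Z\<in>slice_obs Q. \<forall>\<phi>\<in>qrels Q X Y. \<forall>h\<in>slice_maps Z Y.
        T' (cograph Q h \<odot>\<^bsub>Q\<^esub> \<phi>) = cograph Q (fmap T h) \<odot>\<^bsub>Q\<^esub> T' \<phi>) \<and>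
     (\<forall>X\<in>slice_obs Q. cograph Q (map_id (fob T X)) \<preceq>\<^bsub>Q\<^esub> T' (cograph Q (map_id X))) \<and>
     (\<forall>X\<in>slice_obs Q. \<forall>Y\<in>slice_obs Q. \<forall>Z\<in>slice_obs Q. \<forall>\<phi>\<in>qrels Q X Y. \<forall>\<psi>\<in>qrels Q Y Z.
        T' \<psi> \<odot>\<^bsub>Q\<^esub> T' \<phi> \<preceq>\<^bsub>Q\<^esub> T' (\<psi> \<odot>\<^bsub>Q\<^esub> \<phi>)) \<and>
     (\<forall>X\<in>slice_obs Q. \<forall>Y\<in>slice_obs Q. \<forall>\<phi>\<in>qrels Q X Y.
        \<phi> \<odot>\<^bsub>Q\<^esub> cograph Q (eta T X) \<preceq>\<^bsub>Q\<^esub> cograph Q (eta T Y) \<odot>\<^bsub>Q\<^esub> T' \<phi> \<and>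
        T' (T' \<phi>) \<odot>\<^bsub>Q\<^esub> cograph Q (mult T X) \<preceq>\<^bsub>Q\<^esub> cograph Q (mult T Y) \<odot>\<^bsub>Q\<^esub> T' \<phi>)"

definition corresponding ::
  "('u::universe, 'u) quantaloid \<Rightarrow> 'u slice_monad \<Rightarrow> ('u slice_ob \<Rightarrow> 'u slice_map)
    \<Rightarrow> ('u qrel \<Rightarrow> 'u qrel) \<Rightarrow> bool" where
  "corresponding Q T lam T' \<longleftrightarrow>
     (\<forall>X\<in>slice_obs Q. \<forall>Y\<in>slice_obs Q. \<forall>\<phi>\<in>qrels Q X Y.
        mate Q (T' \<phi>) = lam X \<cdot> fmap T (mate Q \<phi>)) \<and>
     (\<forall>X\<in>slice_obs Q. lam X = mate Q (T' (eps Q X)))"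


section \<open>Lax algebras\<close>

definition dist_alg ::
  "('u::universe, 'u) quantaloid \<Rightarrow> 'u slice_monad \<Rightarrow> ('u slice_ob \<Rightarrow> 'u slice_map)
    \<Rightarrow> ('u slice_ob \<times> 'u slice_map, 'u slice_map) category" where
  "dist_alg Q T lam =
     \<lparr>Ob = {(X, p). X \<in> slice_obs Q \<and> p \<in> slice_maps (fob T X) (Pob Q X) \<and>
              yon Q X \<lesssim>\<^bsub>Q,X\<^esub> p \<cdot> eta T X \<and>
              psup Q X \<cdot> Pmap Q p \<cdot> lam X \<cdot> fmap T p \<lesssim>\<^bsub>Q,X\<^esub> p \<cdot> mult T X},
      Hom = (\<lambda>(X, p) (Y, q). {f \<in> slice_maps X Y. Pmap Q f \<cdot> p \<lesssim>\<^bsub>Q,Y\<^esub> q \<cdot> fmap T f}),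
      Comp = (\<cdot>),
      Ide = (\<lambda>(X, p). map_id X)\<rparr>"

definition lax_cat ::
  "('u::universe, 'u) quantaloid \<Rightarrow> 'u slice_monad \<Rightarrow> ('u qrel \<Rightarrow> 'u qrel)
    \<Rightarrow> ('u slice_ob \<times> 'u qrel, 'u slice_map) category" where
  "lax_cat Q T T' =
     \<lparr>Ob = {(X, \<alpha>). X \<in> slice_obs Q \<and> \<alpha> \<in> qrels Q X (fob T X) \<and>
              cograph Q (map_id X) \<preceq>\<^bsub>Q\<^esub> cograph Q (eta T X) \<odot>\<^bsub>Q\<^esub> \<alpha> \<and>
              T' \<alpha> \<odot>\<^bsub>Q\<^esub> \<alpha> \<preceq>\<^bsub>Q\<^esub> cograph Q (mult T X) \<odot>\<^bsub>Q\<^esub> \<alpha>},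
      Hom = (\<lambda>(X, \<alpha>) (Y, \<beta>). {f \<in> slice_maps X Y.
              \<alpha> \<odot>\<^bsub>Q\<^esub> cograph Q f \<preceq>\<^bsub>Q\<^esub> cograph Q (fmap T f) \<odot>\<^bsub>Q\<^esub> \<beta>}),
      Comp = (\<cdot>),
      Ide = (\<lambda>(X, \<alpha>). map_id X)\<rparr>"

definition mate_functor ::
  "('u::universe, 'u) quantaloid
    \<Rightarrow> ('u slice_ob \<times> 'u qrel, 'u slice_map, 'u slice_ob \<times> 'u slice_map, 'u slice_map) functor_data"
  where
  "mate_functor Q = \<lparr>fob = (\<lambda>(X, \<alpha>). (X, mate Q \<alpha>)), farr = (\<lambda>_ _ f. f)\<rparr>"


section \<open>Algebraic morphisms and algebraic functors\<close>

definition lax_algebraic_morphism ::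
  "('u::universe, 'u) quantaloid \<Rightarrow> 'u slice_monad \<Rightarrow> ('u qrel \<Rightarrow> 'u qrel)
    \<Rightarrow> 'u slice_monad \<Rightarrow> ('u qrel \<Rightarrow> 'u qrel) \<Rightarrow> ('u slice_ob \<Rightarrow> 'u qrel) \<Rightarrow> bool" where
  "lax_algebraic_morphism Q T T' S S' h \<longleftrightarrow>
     (\<forall>X\<in>slice_obs Q. h X \<in> qrels Q (fob T X) (fob S X)) \<and>
     (\<forall>X\<in>slice_obs Q. \<forall>Y\<in>slice_obs Q. \<forall>f\<in>slice_maps X Y.
        h X \<odot>\<^bsub>Q\<^esub> cograph Q (fmap T f) \<preceq>\<^bsub>Q\<^esub> cograph Q (fmap S f) \<odot>\<^bsub>Q\<^esub> h Y) \<and>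
     (\<forall>X\<in>slice_obs Q. cograph Q (eta T X) \<preceq>\<^bsub>Q\<^esub> cograph Q (eta S X) \<odot>\<^bsub>Q\<^esub> h X) \<and>
     (\<forall>X\<in>slice_obs Q.
        S' (h X) \<odot>\<^bsub>Q\<^esub> h (fob T X) \<odot>\<^bsub>Q\<^esub> cograph Q (mult T X)
          \<preceq>\<^bsub>Q\<^esub> cograph Q (mult S X) \<odot>\<^bsub>Q\<^esub> h X) \<and>
     (\<forall>X\<in>slice_obs Q. \<forall>Y\<in>slice_obs Q. \<forall>\<phi>\<in>qrels Q X Y.
        S' \<phi> \<odot>\<^bsub>Q\<^esub> h X \<preceq>\<^bsub>Q\<^esub> h Y \<odot>\<^bsub>Q\<^esub> T' \<phi>) \<and>
     (\<forall>X\<in>slice_obs Q. \<forall>\<alpha>\<in>qrels Q X (fob T X).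
        S' (h X \<odot>\<^bsub>Q\<^esub> \<alpha>) \<preceq>\<^bsub>Q\<^esub> S' (h X) \<odot>\<^bsub>Q\<^esub> S' \<alpha>)"

text \<open>
  \<open>dist_algebraic_morphism Q S \<kappa> T lam \<tau>\<close> stands for \<open>\<tau> : \<kappa> \<rightarrow> lam\<close>, with \<open>\<kappa>\<close> belonging to \<open>S\<close> and
  \<open>lam\<close> to \<open>T\<close>: its direction is opposite to that of the corresponding morphism of lax extensions.
\<close>

definition dist_algebraic_morphism ::
  "('u::universe, 'u) quantaloid \<Rightarrow> 'u slice_monad \<Rightarrow> ('u slice_ob \<Rightarrow> 'u slice_map)
    \<Rightarrow> 'u slice_monad \<Rightarrow> ('u slice_ob \<Rightarrow> 'u slice_map) \<Rightarrow> ('u slice_ob \<Rightarrow> 'u slice_map) \<Rightarrow> bool"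
  where
  "dist_algebraic_morphism Q S \<kappa> T lam \<tau> \<longleftrightarrow>
     (\<forall>X\<in>slice_obs Q. \<tau> X \<in> slice_maps (fob S X) (Pob Q (fob T X))) \<and>
     (\<forall>X\<in>slice_obs Q. \<forall>Y\<in>slice_obs Q. \<forall>f\<in>slice_maps X Y.
        Pmap Q (fmap T f) \<cdot> \<tau> X \<lesssim>\<^bsub>Q,fob T Y\<^esub> \<tau> Y \<cdot> fmap S f) \<and>
     (\<forall>X\<in>slice_obs Q. yon Q (fob T X) \<cdot> eta T X \<lesssim>\<^bsub>Q,fob T X\<^esub> \<tau> X \<cdot> eta S X) \<and>
     (\<forall>X\<in>slice_obs Q.
        Pmap Q (mult T X) \<cdot> psup Q (fob T (fob T X)) \<cdot> Pmap Q (\<tau> (fob T X)) \<cdot> \<kappa> (fob T X)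
            \<cdot> fmap S (\<tau> X)
          \<lesssim>\<^bsub>Q,fob T X\<^esub> \<tau> X \<cdot> mult S X) \<and>
     (\<forall>X\<in>slice_obs Q. \<forall>Y\<in>slice_obs Q. \<forall>g\<in>slice_maps Y (Pob Q X).
        psup Q (fob T X) \<cdot> Pmap Q (\<tau> X) \<cdot> \<kappa> X \<cdot> fmap S g
          \<lesssim>\<^bsub>Q,fob T X\<^esub> psup Q (fob T X) \<cdot> Pmap Q (lam X) \<cdot> Pmap Q (fmap T g) \<cdot> \<tau> Y) \<and>
     (\<forall>X\<in>slice_obs Q. \<forall>p\<in>slice_maps (fob T X) (Pob Q X).
        \<kappa> X \<cdot> fmap S (psup Q X) \<cdot> fmap S (Pmap Q p) \<cdot> fmap S (\<tau> X)
          \<lesssim>\<^bsub>Q,fob S X\<^esub>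
        psup Q (fob S X) \<cdot> Pmap Q (\<kappa> X) \<cdot> Pmap Q (fmap S p) \<cdot> \<kappa> (fob T X) \<cdot> fmap S (\<tau> X))"

definition lax_algebraic_functor ::
  "('u::universe, 'u) quantaloid \<Rightarrow> ('u slice_ob \<Rightarrow> 'u qrel)
    \<Rightarrow> ('u slice_ob \<times> 'u qrel, 'u slice_map, 'u slice_ob \<times> 'u qrel, 'u slice_map) functor_data"
  where
  "lax_algebraic_functor Q h = \<lparr>fob = (\<lambda>(X, \<alpha>). (X, h X \<odot>\<^bsub>Q\<^esub> \<alpha>)), farr = (\<lambda>_ _ f. f)\<rparr>"

definition dist_algebraic_functor ::
  "('u::universe, 'u) quantaloid \<Rightarrow> ('u slice_ob \<Rightarrow> 'u slice_map)
    \<Rightarrow> ('u slice_ob \<times> 'u slice_map, 'u slice_map, 'u slice_ob \<times> 'u slice_map, 'u slice_map)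
        functor_data"
  where
  "dist_algebraic_functor Q \<tau> =
     \<lparr>fob = (\<lambda>(X, p). (X, psup Q X \<cdot> Pmap Q p \<cdot> \<tau> X)), farr = (\<lambda>_ _ f. f)\<rparr>"

end

theory Submission
  imports Defs
begin

text \<open>
  A relation from \<open>X\<close> to \<open>Y\<close> is the same thing as a map from \<open>Y\<close> to \<open>P X\<close>: the passage from
  \<open>\<phi>\<close> to \<open>mate Q \<phi>\<close> is an order isomorphism (\<open>mate_le_iff\<close>, \<open>mate_surj\<close>), and it turns the calculus
  of relations into the Kleisli calculus of the presheaf monad. Precomposition with a map becomes
  composition with a cograph on the target side (\<open>mate_cograph_comp\<close>), the functor \<open>P\<close> becomes
  composition with a cograph on the source side (\<open>mate_comp_cograph\<close>), Kleisli composition becomes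
  composition of relations (\<open>mate_comp\<close>), and, by the correspondence of \<open>lam\<close> with \<open>That\<close>, the map
  \<open>lam X \<cdot> fmap T (mate Q \<phi>)\<close> is the mate of \<open>That \<phi>\<close> (\<open>mate_That\<close>). Under this dictionary every
  axiom on maps is the mate of the corresponding axiom on relations. Hence the two categories of
  algebras differ only in the names of their objects (\<open>mate_relabelling\<close>), the conditions on \<open>tau\<close>
  are those on \<open>h\<close>, and \<open>psup Q X \<cdot> Pmap Q (mate Q \<alpha>) \<cdot> tau X\<close> is the mate of \<open>h X\<close> after \<open>\<alpha>\<close>.

  There remains one fact about relations, that \<open>h X\<close> after \<open>\<alpha>\<close> is again a lax algebra and that
  morphisms remain morphisms. Writing composition as juxtaposition and \<open>m\<close>, \<open>n\<close> for the cographs of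
  the two multiplications, the multiplication law is the chain
  \<open>Shat (h \<alpha>) h \<alpha> \<le> Shat h (Shat \<alpha> h) \<alpha> \<le> Shat h h (That \<alpha> \<alpha>) \<le> (Shat h h m) \<alpha> \<le> n h \<alpha>\<close>,
  whose steps are the compatibility of \<open>Shat\<close> with composites \<open>h \<alpha>\<close>, the compatibility of \<open>h\<close> with
  the extensions, the law for \<open>\<alpha>\<close>, and the compatibility of \<open>h\<close> with the multiplications
  (\<open>algebraic_functor_mult\<close>); the unit law and the condition on morphisms take two steps each.
\<close>


section \<open>Small sets\<close>

lemma small_subset: "small A \<Longrightarrow> B \<subseteq> A \<Longrightarrow> small B"
  unfolding small_def using separation by blast

text \<open>
  The union axiom applies only to a set of codes; replacement supplies it by collecting the codes
  of the members of the family.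
\<close>

lemma small_UN:
  fixes A :: "'u::universe set" and F :: "'u \<Rightarrow> 'u set"
  assumes "small A" and "\<And>x. x \<in> A \<Longrightarrow> small (F x)"
  shows "small (\<Union>x\<in>A. F x)"
proof -
  obtain a where a: "elts a = A"
    using assms(1) by (auto simp: small_def)
  obtain b where b: "elts b = (\<lambda>x. mkset (F x)) ` elts a"
    using replacement[of "\<lambda>x. mkset (F x)" a] by auto
  have "(\<Union>y\<in>elts b. elts y) = (\<Union>x\<in>A. F x)"
    unfolding b a using assms(2) by (auto simp: elts_mkset)
  then show ?thesis
    unfolding small_def using union[of b] by simp
qed

lemma small_kpairs: "small A \<Longrightarrow> small B \<Longrightarrow> small (\<Union>a\<in>A. kpair a ` B)"
  by (intro small_UN small_image)

lemma small_codes_of_subsets: "small A \<Longrightarrow> small {y. elts y \<subseteq> A}"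
  unfolding small_def using power_set by blast


section \<open>The hom-lattices of a small quantaloid\<close>

locale base_quantaloid =
  fixes Q :: "('u::universe, 'u) quantaloid"
  assumes small_quantaloid: "small_quantaloid Q"
begin

abbreviation Join :: "'u \<Rightarrow> 'u \<Rightarrow> 'u set \<Rightarrow> 'u" where
  "Join a b A \<equiv> \<Squnion>\<^bsub>Homl Q a b\<^esub> A"

abbreviation Bot :: "'u \<Rightarrow> 'u \<Rightarrow> 'u" where
  "Bot a b \<equiv> \<bottom>\<^bsub>Homl Q a b\<^esub>"

lemma carrier_Homl [simp]: "carrier (Homl Q a b) = Hom Q a b"
  and le_Homl [simp]: "le (Homl Q a b) = leq Q"
  by (simp_all add: Homl_def)

lemma Q_category: "is_category Q"
  using small_quantaloid by (simp add: small_quantaloid_def)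

lemma small_Ob: "small (Ob Q)"
  and small_Hom: "a \<in> Ob Q \<Longrightarrow> b \<in> Ob Q \<Longrightarrow> small (Hom Q a b)"
  using small_quantaloid by (simp_all add: small_quantaloid_def)

lemma Ide_in [simp]: "a \<in> Ob Q \<Longrightarrow> Ide Q a \<in> Hom Q a a"
  using Q_category by (simp add: is_category_def)

lemma Comp_in:
  "f \<in> Hom Q a b \<Longrightarrow> g \<in> Hom Q b c \<Longrightarrow> a \<in> Ob Q \<Longrightarrow> b \<in> Ob Q \<Longrightarrow> c \<in> Ob Q
    \<Longrightarrow> Comp Q g f \<in> Hom Q a c"
  using Q_category by (simp add: is_category_def)

lemma Comp_Ide_right: "f \<in> Hom Q a b \<Longrightarrow> a \<in> Ob Q \<Longrightarrow> b \<in> Ob Q \<Longrightarrow> Comp Q f (Ide Q a) = f"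
  and Comp_Ide_left: "f \<in> Hom Q a b \<Longrightarrow> a \<in> Ob Q \<Longrightarrow> b \<in> Ob Q \<Longrightarrow> Comp Q (Ide Q b) f = f"
  using Q_category by (simp_all add: is_category_def)

lemma Comp_assoc:
  assumes "f \<in> Hom Q a b" "g \<in> Hom Q b c" "h \<in> Hom Q c d"
    and "a \<in> Ob Q" "b \<in> Ob Q" "c \<in> Ob Q" "d \<in> Ob Q"
  shows "Comp Q h (Comp Q g f) = Comp Q (Comp Q h g) f"
  using Q_category assms unfolding is_category_def by blast

lemma Homl_complete_lattice:
  "a \<in> Ob Q \<Longrightarrow> b \<in> Ob Q \<Longrightarrow> complete_lattice (Homl Q a b)"
  using small_quantaloid by (simp add: small_quantaloid_def)

lemma Homl_weak_complete_lattice: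
  "a \<in> Ob Q \<Longrightarrow> b \<in> Ob Q \<Longrightarrow> weak_complete_lattice (Homl Q a b)"
  and Homl_weak_partial_order:
  "a \<in> Ob Q \<Longrightarrow> b \<in> Ob Q \<Longrightarrow> weak_partial_order (Homl Q a b)"
  and Homl_partial_order:
  "a \<in> Ob Q \<Longrightarrow> b \<in> Ob Q \<Longrightarrow> partial_order (Homl Q a b)"
proof -
  assume ab: "a \<in> Ob Q" "b \<in> Ob Q"
  interpret L: complete_lattice "Homl Q a b"
    by (rule Homl_complete_lattice[OF ab])
  show "weak_complete_lattice (Homl Q a b)" "weak_partial_order (Homl Q a b)"
    "partial_order (Homl Q a b)"
    by unfold_locales
qed

lemma leq_refl: "u \<in> Hom Q a b \<Longrightarrow> a \<in> Ob Q \<Longrightarrow> b \<in> Ob Q \<Longrightarrow> leq Q u u"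
  using weak_partial_order.le_refl[OF Homl_weak_partial_order, of a b u] by simp

lemma leq_trans:
  assumes "leq Q u v" "leq Q v w" "u \<in> Hom Q a b" "v \<in> Hom Q a b" "w \<in> Hom Q a b"
    and "a \<in> Ob Q" "b \<in> Ob Q"
  shows "leq Q u w"
  using weak_partial_order.le_trans[OF Homl_weak_partial_order, of a b u v w] assms by simp

lemma leq_antisym:
  assumes "leq Q u v" "leq Q v u" "u \<in> Hom Q a b" "v \<in> Hom Q a b"
    and "a \<in> Ob Q" "b \<in> Ob Q"
  shows "u = v"
  using partial_order.le_antisym[OF Homl_partial_order, of a b u v] assms by simp

lemma Join_in:
  "A \<subseteq> Hom Q a b \<Longrightarrow> a \<in> Ob Q \<Longrightarrow> b \<in> Ob Q \<Longrightarrow> Join a b A \<in> Hom Q a b"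
  using weak_complete_lattice.sup_closed[OF Homl_weak_complete_lattice, of a b A] by simp

lemma Join_le_iff:
  assumes A: "A \<subseteq> Hom Q a b" and z: "z \<in> Hom Q a b" and ab: "a \<in> Ob Q" "b \<in> Ob Q"
  shows "leq Q (Join a b A) z \<longleftrightarrow> (\<forall>u\<in>A. leq Q u z)"
proof
  assume le: "leq Q (Join a b A) z"
  show "\<forall>u\<in>A. leq Q u z"
  proof
    fix u assume u: "u \<in> A"
    have "leq Q u (Join a b A)"
      using weak_complete_lattice.sup_upper[OF Homl_weak_complete_lattice, of a b A u] A u ab by simp
    with le show "leq Q u z"
      using leq_trans[of u "Join a b A" z a b] A u z ab Join_in by blast
  qed
next
  assume "\<forall>u\<in>A. leq Q u z"
  then show "leq Q (Join a b A) z"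
    using weak_complete_lattice.sup_least[OF Homl_weak_complete_lattice, of a b A z] A z ab by simp
qed

lemma Bot_in: "a \<in> Ob Q \<Longrightarrow> b \<in> Ob Q \<Longrightarrow> Bot a b \<in> Hom Q a b"
  and Bot_le: "u \<in> Hom Q a b \<Longrightarrow> a \<in> Ob Q \<Longrightarrow> b \<in> Ob Q \<Longrightarrow> leq Q (Bot a b) u"
proof -
  assume ab: "a \<in> Ob Q" "b \<in> Ob Q"
  interpret L: complete_lattice "Homl Q a b"
    by (rule Homl_complete_lattice[OF ab])
  show "Bot a b \<in> Hom Q a b"
    using L.bottom_closed by simp
  show "leq Q (Bot a b) u" if "u \<in> Hom Q a b"
    using L.bottom_lower[of u] that by simp
qed

text \<open>
  Elements of a hom-lattice are compared through their upper bounds throughout: every supremum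
  in the definitions then dissolves into a universal quantifier, and iterated suprema commute
  because quantifiers do.
\<close>

lemma eq_from_upper_bounds:
  assumes "u \<in> Hom Q a b" "v \<in> Hom Q a b" "a \<in> Ob Q" "b \<in> Ob Q"
    and "\<And>t. t \<in> Hom Q a b \<Longrightarrow> leq Q u t \<longleftrightarrow> leq Q v t"
  shows "u = v"
proof (rule leq_antisym[of u v a b])
  show "leq Q u v"
    using assms(5)[of v] leq_refl[of v a b] assms(1-4) by simp
  show "leq Q v u"
    using assms(5)[of u] leq_refl[of u a b] assms(1-4) by simp
qed (use assms in auto)

lemma Bot_eq_Join: "a \<in> Ob Q \<Longrightarrow> b \<in> Ob Q \<Longrightarrow> Bot a b = Join a b {}"
  by (rule eq_from_upper_bounds[of _ a b]) (auto simp: Bot_in Join_in Bot_le Join_le_iff)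

lemma Comp_Join_right:
  "v \<in> Hom Q b c \<Longrightarrow> A \<subseteq> Hom Q a b \<Longrightarrow> a \<in> Ob Q \<Longrightarrow> b \<in> Ob Q \<Longrightarrow> c \<in> Ob Q
    \<Longrightarrow> Comp Q v (Join a b A) = Join a c (Comp Q v ` A)"
  using small_quantaloid unfolding small_quantaloid_def by blast

lemma Comp_Join_left:
  "u \<in> Hom Q a b \<Longrightarrow> A \<subseteq> Hom Q b c \<Longrightarrow> a \<in> Ob Q \<Longrightarrow> b \<in> Ob Q \<Longrightarrow> c \<in> Ob Q
    \<Longrightarrow> Comp Q (Join b c A) u = Join a c ((\<lambda>v. Comp Q v u) ` A)"
  using small_quantaloid unfolding small_quantaloid_def by blast

lemma Comp_Join_right_le_iff:
  assumes "v \<in> Hom Q b c" "A \<subseteq> Hom Q a b" "t \<in> Hom Q a c" "a \<in> Ob Q" "b \<in> Ob Q" "c \<in> Ob Q"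
  shows "leq Q (Comp Q v (Join a b A)) t \<longleftrightarrow> (\<forall>u\<in>A. leq Q (Comp Q v u) t)"
proof -
  have "Comp Q v ` A \<subseteq> Hom Q a c"
    using assms Comp_in by blast
  then show ?thesis
    using assms by (simp add: Comp_Join_right Join_le_iff)
qed

lemma Comp_Join_left_le_iff:
  assumes "u \<in> Hom Q a b" "A \<subseteq> Hom Q b c" "t \<in> Hom Q a c" "a \<in> Ob Q" "b \<in> Ob Q" "c \<in> Ob Q"
  shows "leq Q (Comp Q (Join b c A) u) t \<longleftrightarrow> (\<forall>v\<in>A. leq Q (Comp Q v u) t)"
proof -
  have "(\<lambda>v. Comp Q v u) ` A \<subseteq> Hom Q a c"
    using assms Comp_in by blast
  then show ?thesis
    using assms by (simp add: Comp_Join_left Join_le_iff)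
qed

lemma Comp_Bot_right_le:
  assumes "v \<in> Hom Q b c" "t \<in> Hom Q a c" "a \<in> Ob Q" "b \<in> Ob Q" "c \<in> Ob Q"
  shows "leq Q (Comp Q v (Bot a b)) t"
  using assms by (simp add: Bot_eq_Join Comp_Join_right_le_iff)

lemma Comp_Bot_left_le:
  assumes "u \<in> Hom Q a b" "t \<in> Hom Q a c" "a \<in> Ob Q" "b \<in> Ob Q" "c \<in> Ob Q"
  shows "leq Q (Comp Q (Bot b c) u) t"
  using assms by (simp add: Bot_eq_Join Comp_Join_left_le_iff)

lemma Join_pair:
  assumes "leq Q u u'" "u \<in> Hom Q a b" "u' \<in> Hom Q a b" "a \<in> Ob Q" "b \<in> Ob Q"
  shows "Join a b {u, u'} = u'"
proof (rule eq_from_upper_bounds[of _ a b])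
  fix t assume "t \<in> Hom Q a b"
  then show "leq Q (Join a b {u, u'}) t \<longleftrightarrow> leq Q u' t"
    using assms leq_trans[of u u' t a b] by (auto simp: Join_le_iff)
qed (use assms in \<open>auto intro: Join_in\<close>)

text \<open>
  Monotonicity is the case of binary suprema: \<open>u \<le> u'\<close> says that \<open>u'\<close> is the supremum of \<open>u\<close>
  and \<open>u'\<close>.
\<close>

lemma Comp_mono:
  assumes le: "leq Q u u'" "leq Q v v'"
    and u: "u \<in> Hom Q a b" "u' \<in> Hom Q a b" and v: "v \<in> Hom Q b c" "v' \<in> Hom Q b c"
    and ob: "a \<in> Ob Q" "b \<in> Ob Q" "c \<in> Ob Q"
  shows "leq Q (Comp Q v u) (Comp Q v' u')"
proof -
  have in': "Comp Q v u \<in> Hom Q a c" "Comp Q v u' \<in> Hom Q a c" "Comp Q v' u' \<in> Hom Q a c"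
    using u v ob Comp_in by auto
  have "leq Q (Comp Q v (Join a b {u, u'})) (Comp Q v u')"
    using Join_pair[OF le(1) u ob(1,2)] leq_refl[OF in'(2) ob(1,3)] by simp
  then have 1: "leq Q (Comp Q v u) (Comp Q v u')"
    using u v ob in' by (simp add: Comp_Join_right_le_iff)
  have "leq Q (Comp Q (Join b c {v, v'}) u') (Comp Q v' u')"
    using Join_pair[OF le(2) v ob(2,3)] leq_refl[OF in'(3) ob(1,3)] by simp
  then have "leq Q (Comp Q v u') (Comp Q v' u')"
    using u v ob in' by (simp add: Comp_Join_left_le_iff)
  with 1 show ?thesis
    using leq_trans in' ob(1,3) by blast
qed


section \<open>The ordered category of relations\<close>

definition is_map :: "'u slice_ob \<Rightarrow> 'u slice_ob \<Rightarrow> 'u slice_map \<Rightarrow> bool" where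
  "is_map X Y f \<longleftrightarrow> X \<in> slice_obs Q \<and> Y \<in> slice_obs Q \<and> f \<in> slice_maps X Y"

definition is_rel :: "'u slice_ob \<Rightarrow> 'u slice_ob \<Rightarrow> 'u qrel \<Rightarrow> bool" where
  "is_rel X Y \<phi> \<longleftrightarrow> X \<in> slice_obs Q \<and> Y \<in> slice_obs Q \<and> \<phi> \<in> qrels Q X Y"

lemma arr_in [simp]: "X \<in> slice_obs Q \<Longrightarrow> x \<in> pts X \<Longrightarrow> arr X x \<in> Ob Q"
  and small_pts [simp]: "X \<in> slice_obs Q \<Longrightarrow> small (pts X)"
  by (auto simp: slice_obs_def)

lemma is_mapD:
  assumes "is_map X Y f"
  shows "X \<in> slice_obs Q" "Y \<in> slice_obs Q" "src f = X" "trg f = Y" "f \<in> slice_maps X Y"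
    and "x \<in> pts X \<Longrightarrow> app f x \<in> pts Y" "x \<in> pts X \<Longrightarrow> arr Y (app f x) = arr X x"
  using assms by (auto simp: is_map_def slice_maps_def)

lemma is_relD:
  assumes "is_rel X Y \<phi>"
  shows "X \<in> slice_obs Q" "Y \<in> slice_obs Q" "rsrc \<phi> = X" "rtrg \<phi> = Y" "\<phi> \<in> qrels Q X Y"
    and "x \<in> pts X \<Longrightarrow> y \<in> pts Y \<Longrightarrow> rval \<phi> x y \<in> Hom Q (arr X x) (arr Y y)"
  using assms by (auto simp: is_rel_def qrels_def PiE_iff)

lemma map_eqI:
  assumes f: "is_map X Y f" and g: "is_map X Y g" and eq: "\<And>x. x \<in> pts X \<Longrightarrow> app f x = app g x"
  shows "f = g"
proof -
  have "app f = app g"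
    using f g eq by (intro extensionalityI[of _ "pts X"]) (auto simp: is_map_def slice_maps_def PiE_def)
  then show ?thesis
    using f g by (auto simp: is_map_def slice_maps_def)
qed

lemma rel_eqI:
  assumes f: "is_rel X Y \<phi>" and g: "is_rel X Y \<psi>"
    and eq: "\<And>x y. x \<in> pts X \<Longrightarrow> y \<in> pts Y \<Longrightarrow> rval \<phi> x y = rval \<psi> x y"
  shows "\<phi> = \<psi>"
proof -
  have "rval \<phi> = rval \<psi>"
  proof (rule extensionalityI[of _ "pts X"])
    fix x assume x: "x \<in> pts X"
    then show "rval \<phi> x = rval \<psi> x"
      using f g eq by (intro extensionalityI[of _ "pts Y"]) (auto simp: is_rel_def qrels_def PiE_iff)
  qed (use f g in \<open>auto simp: is_rel_def qrels_def PiE_def\<close>)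
  then show ?thesis
    using f g by (auto simp: is_rel_def qrels_def)
qed

lemma is_map_comp:
  assumes f: "is_map X Y f" and g: "is_map Y Z g"
  shows "is_map X Z (g \<cdot> f)"
proof -
  have "app g (app f x) \<in> pts Z \<and> arr Z (app g (app f x)) = arr X x" if "x \<in> pts X" for x
    using that f g by (simp add: is_mapD)
  then show ?thesis
    using is_mapD(1,3)[OF f] is_mapD(2,4)[OF g]
    by (auto simp: is_map_def slice_maps_def map_comp_def)
qed

lemma is_map_id: "X \<in> slice_obs Q \<Longrightarrow> is_map X X (map_id X)"
  by (auto simp: is_map_def slice_maps_def map_id_def)

lemma app_comp: "is_map X Y f \<Longrightarrow> x \<in> pts X \<Longrightarrow> app (g \<cdot> f) x = app g (app f x)"
  by (simp add: map_comp_def is_mapD(3))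

lemma map_comp_assoc:
  assumes "is_map X Y f" "is_map Y Z g" "is_map Z W k"
  shows "(k \<cdot> g) \<cdot> f = k \<cdot> g \<cdot> f"
proof (rule map_eqI[of X W])
  show "app ((k \<cdot> g) \<cdot> f) x = app (k \<cdot> g \<cdot> f) x" if x: "x \<in> pts X" for x
    using x app_comp[OF assms(1) x] app_comp[OF assms(2) is_mapD(6)[OF assms(1) x]]
      app_comp[OF is_map_comp[OF assms(1,2)] x]
    by (simp add: app_comp[OF assms(1) x])
qed (use assms in \<open>auto intro: is_map_comp\<close>)

lemma map_id_left: "is_map X Y f \<Longrightarrow> map_id Y \<cdot> f = f"
  and map_id_right: "is_map X Y f \<Longrightarrow> f \<cdot> map_id X = f"
proof -
  assume f: "is_map X Y f"
  note id = is_map_id[OF is_mapD(1)[OF f]] is_map_id[OF is_mapD(2)[OF f]]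
  show "map_id Y \<cdot> f = f"
    using is_mapD(6)[OF f]
    by (intro map_eqI[OF is_map_comp[OF f id(2)] f]) (simp add: app_comp[OF f] map_id_def)
  show "f \<cdot> map_id X = f"
    by (rule map_eqI[OF is_map_comp[OF id(1) f] f], simp add: app_comp[OF id(1)], simp add: map_id_def)
qed

lemma Comp_rval_in:
  assumes "is_rel X Y \<phi>" "is_rel Y Z \<psi>" "x \<in> pts X" "y \<in> pts Y" "z \<in> pts Z"
  shows "Comp Q (rval \<psi> y z) (rval \<phi> x y) \<in> Hom Q (arr X x) (arr Z z)"
  using assms by (intro Comp_in[of _ _ "arr Y y"]) (auto simp: is_relD)

lemma is_rel_comp:
  assumes \<phi>: "is_rel X Y \<phi>" and \<psi>: "is_rel Y Z \<psi>"
  shows "is_rel X Z (\<psi> \<odot>\<^bsub>Q\<^esub> \<phi>)"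
proof -
  have "Join (arr X x) (arr Z z) ((\<lambda>y. Comp Q (rval \<psi> y z) (rval \<phi> x y)) ` pts Y)
      \<in> Hom Q (arr X x) (arr Z z)" if "x \<in> pts X" "z \<in> pts Z" for x z
    using that \<phi> \<psi> by (intro Join_in image_subsetI Comp_rval_in[OF \<phi> \<psi>]) (auto simp: is_relD)
  then show ?thesis
    using \<phi> \<psi> by (auto simp: is_rel_def qrels_def qrel_comp_def)
qed

lemma rval_comp:
  assumes "is_rel X Y \<phi>" "is_rel Y Z \<psi>" "x \<in> pts X" "z \<in> pts Z"
  shows "rval (\<psi> \<odot>\<^bsub>Q\<^esub> \<phi>) x z
    = Join (arr X x) (arr Z z) ((\<lambda>y. Comp Q (rval \<psi> y z) (rval \<phi> x y)) ` pts Y)"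
  using assms by (simp add: qrel_comp_def is_relD)

lemma rval_comp_le_iff:
  assumes "is_rel X Y \<phi>" "is_rel Y Z \<psi>" "x \<in> pts X" "z \<in> pts Z"
    and "t \<in> Hom Q (arr X x) (arr Z z)"
  shows "leq Q (rval (\<psi> \<odot>\<^bsub>Q\<^esub> \<phi>) x z) t
    \<longleftrightarrow> (\<forall>y\<in>pts Y. leq Q (Comp Q (rval \<psi> y z) (rval \<phi> x y)) t)"
proof -
  have "(\<lambda>y. Comp Q (rval \<psi> y z) (rval \<phi> x y)) ` pts Y \<subseteq> Hom Q (arr X x) (arr Z z)"
    using assms Comp_rval_in by blast
  then show ?thesis
    using assms by (simp add: rval_comp Join_le_iff is_relD)
qed

lemma rel_eq_from_upper_bounds:
  assumes "is_rel X Y \<phi>" "is_rel X Y \<psi>"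
    and "\<And>x y t. x \<in> pts X \<Longrightarrow> y \<in> pts Y \<Longrightarrow> t \<in> Hom Q (arr X x) (arr Y y)
      \<Longrightarrow> leq Q (rval \<phi> x y) t \<longleftrightarrow> leq Q (rval \<psi> x y) t"
  shows "\<phi> = \<psi>"
proof (rule rel_eqI[OF assms(1,2)])
  fix x y assume "x \<in> pts X" "y \<in> pts Y"
  then show "rval \<phi> x y = rval \<psi> x y"
    using assms by (intro eq_from_upper_bounds[of _ "arr X x" "arr Y y"]) (auto simp: is_relD)
qed

text \<open>
  Both composites are bounded by \<open>t\<close> exactly if all threefold composites
  \<open>Comp Q (Comp Q (rval \<chi> z w) (rval \<psi> y z)) (rval \<phi> x y)\<close> are.
\<close>

lemma rel_comp_assoc:
  assumes \<phi>: "is_rel X Y \<phi>" and \<psi>: "is_rel Y Z \<psi>" and \<chi>: "is_rel Z W \<chi>"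
  shows "(\<chi> \<odot>\<^bsub>Q\<^esub> \<psi>) \<odot>\<^bsub>Q\<^esub> \<phi> = \<chi> \<odot>\<^bsub>Q\<^esub> \<psi> \<odot>\<^bsub>Q\<^esub> \<phi>"
proof (rule rel_eq_from_upper_bounds[of X W])
  note ob = is_relD(1,2)[OF \<phi>] is_relD(1,2)[OF \<psi>] is_relD(1,2)[OF \<chi>]
  fix x w t assume x: "x \<in> pts X" and w: "w \<in> pts W" and t: "t \<in> Hom Q (arr X x) (arr W w)"
  have l: "leq Q (Comp Q (rval (\<chi> \<odot>\<^bsub>Q\<^esub> \<psi>) y w) (rval \<phi> x y)) t
    \<longleftrightarrow> (\<forall>z\<in>pts Z. leq Q (Comp Q (Comp Q (rval \<chi> z w) (rval \<psi> y z)) (rval \<phi> x y)) t)"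
    if y: "y \<in> pts Y" for y
  proof -
    have "(\<lambda>z. Comp Q (rval \<chi> z w) (rval \<psi> y z)) ` pts Z \<subseteq> Hom Q (arr Y y) (arr W w)"
      using Comp_rval_in[OF \<psi> \<chi> y _ w] by blast
    then show ?thesis
      using x y w t ob is_relD(6)[OF \<phi> x y] by (simp add: rval_comp[OF \<psi> \<chi> y w] Comp_Join_left_le_iff)
  qed
  have r: "leq Q (Comp Q (rval \<chi> z w) (rval (\<psi> \<odot>\<^bsub>Q\<^esub> \<phi>) x z)) t
    \<longleftrightarrow> (\<forall>y\<in>pts Y. leq Q (Comp Q (Comp Q (rval \<chi> z w) (rval \<psi> y z)) (rval \<phi> x y)) t)"
    if z: "z \<in> pts Z" for z
  proof -
    have "(\<lambda>y. Comp Q (rval \<psi> y z) (rval \<phi> x y)) ` pts Y \<subseteq> Hom Q (arr X x) (arr Z z)"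
      using Comp_rval_in[OF \<phi> \<psi> x _ z] by blast
    moreover have "Comp Q (rval \<chi> z w) (Comp Q (rval \<psi> y z) (rval \<phi> x y))
        = Comp Q (Comp Q (rval \<chi> z w) (rval \<psi> y z)) (rval \<phi> x y)" if y: "y \<in> pts Y" for y
      using x y z w \<phi> \<psi> \<chi> ob
      by (intro Comp_assoc[of _ "arr X x" "arr Y y" _ "arr Z z" _ "arr W w"]) (auto simp: is_relD)
    ultimately show ?thesis
      using x z w t ob is_relD(6)[OF \<chi> z w] by (simp add: rval_comp[OF \<phi> \<psi> x z] Comp_Join_right_le_iff)
  qed
  show "leq Q (rval ((\<chi> \<odot>\<^bsub>Q\<^esub> \<psi>) \<odot>\<^bsub>Q\<^esub> \<phi>) x w) t \<longleftrightarrow> leq Q (rval (\<chi> \<odot>\<^bsub>Q\<^esub> \<psi> \<odot>\<^bsub>Q\<^esub> \<phi>) x w) t"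
    unfolding rval_comp_le_iff[OF \<phi> is_rel_comp[OF \<psi> \<chi>] x w t]
      rval_comp_le_iff[OF is_rel_comp[OF \<phi> \<psi>] \<chi> x w t]
    using l r by blast
qed (use assms in \<open>auto intro: is_rel_comp\<close>)

lemma rel_le_iff:
  assumes "is_rel X Y \<phi>" "is_rel X Y \<psi>"
  shows "\<phi> \<preceq>\<^bsub>Q\<^esub> \<psi> \<longleftrightarrow> (\<forall>x\<in>pts X. \<forall>y\<in>pts Y. leq Q (rval \<phi> x y) (rval \<psi> x y))"
  using assms by (simp add: qrel_le_def is_relD)

lemma rel_le_refl: "is_rel X Y \<phi> \<Longrightarrow> \<phi> \<preceq>\<^bsub>Q\<^esub> \<phi>"
  by (auto simp: rel_le_iff is_relD intro!: leq_refl[OF is_relD(6)])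

lemma rel_le_trans:
  assumes "\<phi> \<preceq>\<^bsub>Q\<^esub> \<psi>" "\<psi> \<preceq>\<^bsub>Q\<^esub> \<chi>" "is_rel X Y \<phi>" "is_rel X Y \<psi>" "is_rel X Y \<chi>"
  shows "\<phi> \<preceq>\<^bsub>Q\<^esub> \<chi>"
  unfolding rel_le_iff[OF assms(3,5)]
proof (intro ballI)
  fix x y assume xy: "x \<in> pts X" "y \<in> pts Y"
  show "leq Q (rval \<phi> x y) (rval \<chi> x y)"
  proof (rule leq_trans)
    show "leq Q (rval \<phi> x y) (rval \<psi> x y)" "leq Q (rval \<psi> x y) (rval \<chi> x y)"
      using assms(1)[unfolded rel_le_iff[OF assms(3,4)]] assms(2)[unfolded rel_le_iff[OF assms(4,5)]] xy
      by simp_all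
  qed (use xy is_relD(1,2)[OF assms(3)] in \<open>auto intro: is_relD(6)[OF assms(3)]
        is_relD(6)[OF assms(4)] is_relD(6)[OF assms(5)]\<close>)
qed

lemma rel_le_antisym:
  assumes "\<phi> \<preceq>\<^bsub>Q\<^esub> \<psi>" "\<psi> \<preceq>\<^bsub>Q\<^esub> \<phi>" "is_rel X Y \<phi>" "is_rel X Y \<psi>"
  shows "\<phi> = \<psi>"
proof (rule rel_eqI[OF assms(3,4)])
  fix x y assume xy: "x \<in> pts X" "y \<in> pts Y"
  show "rval \<phi> x y = rval \<psi> x y"
  proof (rule leq_antisym)
    show "leq Q (rval \<phi> x y) (rval \<psi> x y)" "leq Q (rval \<psi> x y) (rval \<phi> x y)"
      using assms(1)[unfolded rel_le_iff[OF assms(3,4)]] assms(2)[unfolded rel_le_iff[OF assms(4,3)]] xy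
      by simp_all
  qed (use xy is_relD(1,2)[OF assms(3)] in \<open>auto intro: is_relD(6)[OF assms(3)] is_relD(6)[OF assms(4)]\<close>)
qed

lemma rel_comp_mono:
  assumes le: "\<phi> \<preceq>\<^bsub>Q\<^esub> \<phi>'" "\<psi> \<preceq>\<^bsub>Q\<^esub> \<psi>'"
    and \<phi>: "is_rel X Y \<phi>" "is_rel X Y \<phi>'" and \<psi>: "is_rel Y Z \<psi>" "is_rel Y Z \<psi>'"
  shows "\<psi> \<odot>\<^bsub>Q\<^esub> \<phi> \<preceq>\<^bsub>Q\<^esub> \<psi>' \<odot>\<^bsub>Q\<^esub> \<phi>'"
  unfolding rel_le_iff[OF is_rel_comp[OF \<phi>(1) \<psi>(1)] is_rel_comp[OF \<phi>(2) \<psi>(2)]]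
proof (intro ballI)
  fix x z assume x: "x \<in> pts X" and z: "z \<in> pts Z"
  note ob = is_relD(1,2)[OF \<phi>(1)] is_relD(1,2)[OF \<psi>(1)]
  let ?t = "rval (\<psi>' \<odot>\<^bsub>Q\<^esub> \<phi>') x z"
  have t: "?t \<in> Hom Q (arr X x) (arr Z z)"
    by (rule is_relD(6)[OF is_rel_comp[OF \<phi>(2) \<psi>(2)] x z])
  have 1: "\<forall>y\<in>pts Y. leq Q (Comp Q (rval \<psi>' y z) (rval \<phi>' x y)) ?t"
    using rval_comp_le_iff[OF \<phi>(2) \<psi>(2) x z t] leq_refl[OF t] x z ob by simp
  have "leq Q (Comp Q (rval \<psi> y z) (rval \<phi> x y)) ?t" if y: "y \<in> pts Y" for y
  proof (rule leq_trans)
    show "leq Q (Comp Q (rval \<psi> y z) (rval \<phi> x y)) (Comp Q (rval \<psi>' y z) (rval \<phi>' x y))"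
    proof (rule Comp_mono)
      show "leq Q (rval \<phi> x y) (rval \<phi>' x y)" "leq Q (rval \<psi> y z) (rval \<psi>' y z)"
        using le(1)[unfolded rel_le_iff[OF \<phi>]] le(2)[unfolded rel_le_iff[OF \<psi>]] x y z by simp_all
    qed (use x y z ob in \<open>auto intro: is_relD(6)[OF \<phi>(1)] is_relD(6)[OF \<phi>(2)]
          is_relD(6)[OF \<psi>(1)] is_relD(6)[OF \<psi>(2)]\<close>)
  qed (use 1 t x y z \<phi> \<psi> ob in \<open>auto intro: Comp_rval_in\<close>)
  then show "leq Q (rval (\<psi> \<odot>\<^bsub>Q\<^esub> \<phi>) x z) ?t"
    unfolding rval_comp_le_iff[OF \<phi>(1) \<psi>(1) x z t] by blast
qed

lemma rel_comp_mono_right: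
  assumes "\<phi> \<preceq>\<^bsub>Q\<^esub> \<phi>'" "is_rel X Y \<phi>" "is_rel X Y \<phi>'" "is_rel Y Z \<psi>"
  shows "\<psi> \<odot>\<^bsub>Q\<^esub> \<phi> \<preceq>\<^bsub>Q\<^esub> \<psi> \<odot>\<^bsub>Q\<^esub> \<phi>'"
  using rel_comp_mono[OF assms(1) rel_le_refl[OF assms(4)]] assms by blast

lemma rel_comp_mono_left:
  assumes "\<psi> \<preceq>\<^bsub>Q\<^esub> \<psi>'" "is_rel X Y \<phi>" "is_rel Y Z \<psi>" "is_rel Y Z \<psi>'"
  shows "\<psi> \<odot>\<^bsub>Q\<^esub> \<phi> \<preceq>\<^bsub>Q\<^esub> \<psi>' \<odot>\<^bsub>Q\<^esub> \<phi>"
  using rel_comp_mono[OF rel_le_refl[OF assms(2)] assms(1)] assms by blast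

lemma is_rel_cograph:
  assumes "is_map X Y f"
  shows "is_rel Y X (cograph Q f)"
proof -
  have "Ide Q (arr X x) \<in> Hom Q (arr Y (app f x)) (arr X x)" if "x \<in> pts X" for x
    using assms that by (simp add: is_mapD)
  then show ?thesis
    using assms by (auto simp: is_rel_def qrels_def cograph_def is_mapD Bot_in)
qed

lemma rval_cograph:
  assumes "is_map X Y f" "x \<in> pts X" "y \<in> pts Y"
  shows "rval (cograph Q f) y x = (if app f x = y then Ide Q (arr X x) else Bot (arr Y y) (arr X x))"
  using assms by (simp add: cograph_def is_mapD)

text \<open>
  In the supremum over the points \<open>y\<close> only \<open>y = app f z\<close> contributes, all other terms being
  composites with a bottom element. So composing with a cograph on the target side is substitution.
\<close>

lemma rval_cograph_comp:
  assumes f: "is_map Z Y f" and \<phi>: "is_rel X Y \<phi>" and x: "x \<in> pts X" and z: "z \<in> pts Z"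
  shows "rval (cograph Q f \<odot>\<^bsub>Q\<^esub> \<phi>) x z = rval \<phi> x (app f z)"
proof (rule eq_from_upper_bounds)
  note ob = is_relD(1,2)[OF \<phi>] is_mapD(1,2)[OF f]
  note co = is_rel_cograph[OF f]
  have fz: "app f z \<in> pts Y" and az: "arr Y (app f z) = arr Z z"
    using f z by (auto simp: is_mapD)
  show "rval (cograph Q f \<odot>\<^bsub>Q\<^esub> \<phi>) x z \<in> Hom Q (arr X x) (arr Z z)"
    using is_relD(6)[OF is_rel_comp[OF \<phi> co] x z] .
  show hom: "rval \<phi> x (app f z) \<in> Hom Q (arr X x) (arr Z z)"
    using is_relD(6)[OF \<phi> x fz] az by simp
  show "arr X x \<in> Ob Q" "arr Z z \<in> Ob Q"
    using ob x z by auto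
  fix t assume t: "t \<in> Hom Q (arr X x) (arr Z z)"
  have "leq Q (Comp Q (rval (cograph Q f) y z) (rval \<phi> x y)) t
      \<longleftrightarrow> (y = app f z \<longrightarrow> leq Q (rval \<phi> x (app f z)) t)" if y: "y \<in> pts Y" for y
  proof (cases "y = app f z")
    case True
    then show ?thesis
      using Comp_Ide_left[OF hom] x z ob fz by (simp add: rval_cograph[OF f])
  next
    case False
    then show ?thesis
      using Comp_Bot_left_le[OF is_relD(6)[OF \<phi> x y] t] x y z ob by (simp add: rval_cograph[OF f])
  qed
  then show "leq Q (rval (cograph Q f \<odot>\<^bsub>Q\<^esub> \<phi>) x z) t \<longleftrightarrow> leq Q (rval \<phi> x (app f z)) t"
    unfolding rval_comp_le_iff[OF \<phi> co x z t] using fz by blast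
qed

text \<open>
  On the source side a whole fibre of \<open>f\<close> contributes. The right hand side is the formula that
  defines \<open>Pmap Q f\<close>.
\<close>

lemma rval_comp_cograph:
  assumes f: "is_map X Y f" and \<psi>: "is_rel X Z \<psi>" and y: "y \<in> pts Y" and z: "z \<in> pts Z"
  shows "rval (\<psi> \<odot>\<^bsub>Q\<^esub> cograph Q f) y z
    = Join (arr Y y) (arr Z z) ((\<lambda>x. rval \<psi> x z) ` {x \<in> pts X. app f x = y})"
    (is "_ = Join _ _ ?A")
proof (rule eq_from_upper_bounds)
  note ob = is_relD(1,2)[OF \<psi>] is_mapD(1,2)[OF f]
  note co = is_rel_cograph[OF f]
  have hom: "rval \<psi> x z \<in> Hom Q (arr Y y) (arr Z z)" if "x \<in> pts X" "app f x = y" for x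
    using is_relD(6)[OF \<psi> that(1) z] is_mapD(7)[OF f that(1)] that(2) by simp
  then have A: "?A \<subseteq> Hom Q (arr Y y) (arr Z z)"
    by blast
  show "rval (\<psi> \<odot>\<^bsub>Q\<^esub> cograph Q f) y z \<in> Hom Q (arr Y y) (arr Z z)"
    using is_relD(6)[OF is_rel_comp[OF co \<psi>] y z] .
  show ob': "arr Y y \<in> Ob Q" "arr Z z \<in> Ob Q"
    using ob y z by auto
  show "Join (arr Y y) (arr Z z) ?A \<in> Hom Q (arr Y y) (arr Z z)"
    by (rule Join_in[OF A ob'])
  fix t assume t: "t \<in> Hom Q (arr Y y) (arr Z z)"
  have "leq Q (Comp Q (rval \<psi> x z) (rval (cograph Q f) y x)) t
      \<longleftrightarrow> (app f x = y \<longrightarrow> leq Q (rval \<psi> x z) t)" if x: "x \<in> pts X" for x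
  proof (cases "app f x = y")
    case True
    then show ?thesis
      using Comp_Ide_right[OF is_relD(6)[OF \<psi> x z]] x y z ob by (simp add: rval_cograph[OF f])
  next
    case False
    then show ?thesis
      using Comp_Bot_right_le[OF is_relD(6)[OF \<psi> x z] t] x y z ob by (simp add: rval_cograph[OF f])
  qed
  then show "leq Q (rval (\<psi> \<odot>\<^bsub>Q\<^esub> cograph Q f) y z) t \<longleftrightarrow> leq Q (Join (arr Y y) (arr Z z) ?A) t"
    unfolding rval_comp_le_iff[OF co \<psi> y z t] Join_le_iff[OF A t ob'] by blast
qed

lemma cograph_id_comp:
  assumes "is_rel X Y \<phi>"
  shows "cograph Q (map_id Y) \<odot>\<^bsub>Q\<^esub> \<phi> = \<phi>"
proof (rule rel_eqI)
  have id: "is_map Y Y (map_id Y)"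
    using assms by (intro is_map_id is_relD)
  show "is_rel X Y (cograph Q (map_id Y) \<odot>\<^bsub>Q\<^esub> \<phi>)"
    by (rule is_rel_comp[OF assms is_rel_cograph[OF id]])
  show "rval (cograph Q (map_id Y) \<odot>\<^bsub>Q\<^esub> \<phi>) x y = rval \<phi> x y" if "x \<in> pts X" "y \<in> pts Y" for x y
    using rval_cograph_comp[OF id assms that] that by (simp add: map_id_def)
qed (rule assms)

lemma comp_cograph_id:
  assumes "is_rel X Y \<phi>"
  shows "\<phi> \<odot>\<^bsub>Q\<^esub> cograph Q (map_id X) = \<phi>"
proof (rule rel_eqI)
  have id: "is_map X X (map_id X)"
    using assms by (intro is_map_id is_relD)
  show "is_rel X Y (\<phi> \<odot>\<^bsub>Q\<^esub> cograph Q (map_id X))"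
    by (rule is_rel_comp[OF is_rel_cograph[OF id] assms])
  show "rval (\<phi> \<odot>\<^bsub>Q\<^esub> cograph Q (map_id X)) x y = rval \<phi> x y" if "x \<in> pts X" "y \<in> pts Y" for x y
  proof -
    have "{x' \<in> pts X. app (map_id X) x' = x} = {x}"
      using that by (auto simp: map_id_def)
    then show ?thesis
      using rval_comp_cograph[OF id assms that] that assms leq_refl
        Join_pair[of "rval \<phi> x y" "rval \<phi> x y" "arr X x" "arr Y y"]
      by (simp add: is_relD)
  qed
qed (rule assms)

lemma cograph_comp:
  assumes f: "is_map X Y f" and g: "is_map Y Z g"
  shows "cograph Q (g \<cdot> f) = cograph Q f \<odot>\<^bsub>Q\<^esub> cograph Q g"
proof (rule rel_eqI[of Z X])
  show "rval (cograph Q (g \<cdot> f)) z x = rval (cograph Q f \<odot>\<^bsub>Q\<^esub> cograph Q g) z x"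
    if "z \<in> pts Z" "x \<in> pts X" for z x
    using that f rval_cograph_comp[OF f is_rel_cograph[OF g] that]
      rval_cograph[OF is_map_comp[OF f g] that(2,1)] rval_cograph[OF g]
    by (simp add: is_mapD app_comp)
qed (use f g in \<open>auto intro: is_rel_comp is_rel_cograph is_map_comp\<close>)


section \<open>Relations as maps into presheaves\<close>

lemma fam_cong: "(\<And>x. x \<in> pts X \<Longrightarrow> u x = v x) \<Longrightarrow> fam X s u = fam X s v"
  unfolding fam_def by (metis (no_types, lifting) image_cong)

lemma fam_in_Pob:
  "s \<in> Ob Q \<Longrightarrow> (\<And>x. x \<in> pts X \<Longrightarrow> u x \<in> Hom Q (arr X x) s) \<Longrightarrow> fam X s u \<in> pts (Pob Q X)"
  by (auto simp: Pob_def Let_def)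

lemma arr_Pob: "\<sigma> \<in> pts (Pob Q X) \<Longrightarrow> arr (Pob Q X) \<sigma> = fam_cod \<sigma>"
  by (simp add: Pob_def Let_def)

lemma PobE:
  assumes "\<sigma> \<in> pts (Pob Q X)"
  obtains s u where "\<sigma> = fam X s u" "s \<in> Ob Q" "\<And>x. x \<in> pts X \<Longrightarrow> u x \<in> Hom Q (arr X x) s"
proof -
  have "\<exists>s u. \<sigma> = fam X s u \<and> s \<in> Ob Q \<and> (\<forall>x\<in>pts X. u x \<in> Hom Q (arr X x) s)"
    using assms by (simp add: Pob_def Let_def)
  with that show ?thesis
    by blast
qed

lemma Pob_decode:
  assumes "X \<in> slice_obs Q" "\<sigma> \<in> pts (Pob Q X)"
  shows "fam_cod \<sigma> \<in> Ob Q"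
    and "x \<in> pts X \<Longrightarrow> fam_at \<sigma> x \<in> Hom Q (arr X x) (fam_cod \<sigma>)"
    and "fam X (fam_cod \<sigma>) (fam_at \<sigma>) = \<sigma>"
proof -
  obtain s u where *: "\<sigma> = fam X s u" "s \<in> Ob Q" "\<And>x. x \<in> pts X \<Longrightarrow> u x \<in> Hom Q (arr X x) s"
    using PobE[OF assms(2)] by blast
  show "fam_cod \<sigma> \<in> Ob Q" "x \<in> pts X \<Longrightarrow> fam_at \<sigma> x \<in> Hom Q (arr X x) (fam_cod \<sigma>)"
    using * assms(1) by auto
  show "fam X (fam_cod \<sigma>) (fam_at \<sigma>) = \<sigma>"
    unfolding *(1) fam_cod_fam by (rule fam_cong) (simp add: assms(1))
qed

text \<open>
  A family is a codomain together with a graph, and all graphs with codomain \<open>s\<close> are subsets of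
  one small set of pairs, so that the power set axiom bounds them.
\<close>

lemma small_Pob:
  assumes X: "X \<in> slice_obs Q"
  shows "small (pts (Pob Q X))"
proof (rule small_subset)
  let ?V = "\<lambda>s. \<Union>x\<in>pts X. Hom Q (arr X x) s"
  let ?G = "\<lambda>s. {g. elts g \<subseteq> (\<Union>x\<in>pts X. kpair x ` ?V s)}"
  show "small (\<Union>s\<in>Ob Q. kpair s ` ?G s)"
    using X by (intro small_UN small_image small_codes_of_subsets small_kpairs small_Ob)
      (auto intro: small_Hom)
  show "pts (Pob Q X) \<subseteq> (\<Union>s\<in>Ob Q. kpair s ` ?G s)"
  proof
    fix \<sigma> assume "\<sigma> \<in> pts (Pob Q X)"
    then obtain s u where *: "\<sigma> = fam X s u" "s \<in> Ob Q" "\<And>x. x \<in> pts X \<Longrightarrow> u x \<in> Hom Q (arr X x) s"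
      using PobE by blast
    have "mkset ((\<lambda>x. kpair x (u x)) ` pts X) \<in> ?G s"
      using X *(3) by (auto simp: elts_mkset small_image)
    then show "\<sigma> \<in> (\<Union>s\<in>Ob Q. kpair s ` ?G s)"
      using *(1,2) by (auto simp: fam_def)
  qed
qed

lemma Pob_in:
  assumes "X \<in> slice_obs Q"
  shows "Pob Q X \<in> slice_obs Q"
proof -
  have "arr (Pob Q X) \<in> pts (Pob Q X) \<rightarrow>\<^sub>E Ob Q"
    by (auto simp: Pob_def Let_def)
  with small_Pob[OF assms] show ?thesis
    unfolding slice_obs_def by blast
qed

lemma is_map_mate:
  assumes "is_rel X Y \<phi>"
  shows "is_map Y (Pob Q X) (mate Q \<phi>)"
proof -
  have "fam X (arr Y y) (\<lambda>x. rval \<phi> x y) \<in> pts (Pob Q X)" if "y \<in> pts Y" for y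
    using that assms by (intro fam_in_Pob) (auto simp: is_relD)
  then show ?thesis
    using assms by (auto simp: is_map_def slice_maps_def mate_def is_relD Pob_in arr_Pob)
qed

lemma app_mate:
  assumes "is_rel X Y \<phi>" "y \<in> pts Y"
  shows "app (mate Q \<phi>) y = fam X (arr Y y) (\<lambda>x. rval \<phi> x y)"
  using assms by (simp add: mate_def is_relD)

lemma mate_le_iff:
  assumes \<phi>: "is_rel X Y \<phi>" and \<psi>: "is_rel X Y \<psi>"
  shows "mate Q \<phi> \<lesssim>\<^bsub>Q,X\<^esub> mate Q \<psi> \<longleftrightarrow> \<phi> \<preceq>\<^bsub>Q\<^esub> \<psi>"
proof -
  have "fam_le Q X (app (mate Q \<phi>) y) (app (mate Q \<psi>) y)
      \<longleftrightarrow> (\<forall>x\<in>pts X. leq Q (rval \<phi> x y) (rval \<psi> x y))" if "y \<in> pts Y" for y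
    unfolding app_mate[OF \<phi> that] app_mate[OF \<psi> that] fam_le_def
    by (simp add: is_relD(1)[OF \<phi>])
  then show ?thesis
    unfolding map_le_def rel_le_iff[OF assms]
      is_mapD(3,4)[OF is_map_mate[OF \<phi>]] is_mapD(3,4)[OF is_map_mate[OF \<psi>]] by auto
qed

lemma mate_inject:
  assumes "is_rel X Y \<phi>" "is_rel X Y \<psi>" "mate Q \<phi> = mate Q \<psi>"
  shows "\<phi> = \<psi>"
  using mate_le_iff[OF assms(1,2)] mate_le_iff[OF assms(2,1)] mate_le_iff[OF assms(1,1)]
    rel_le_refl[OF assms(1)] assms(3) rel_le_antisym[OF _ _ assms(1,2)]
  by simp

lemma mate_cograph_comp:
  assumes f: "is_map Z Y f" and \<phi>: "is_rel X Y \<phi>"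
  shows "mate Q (cograph Q f \<odot>\<^bsub>Q\<^esub> \<phi>) = mate Q \<phi> \<cdot> f"
proof (rule map_eqI[of Z "Pob Q X"])
  note c = is_rel_comp[OF \<phi> is_rel_cograph[OF f]]
  show "is_map Z (Pob Q X) (mate Q (cograph Q f \<odot>\<^bsub>Q\<^esub> \<phi>))"
    by (rule is_map_mate[OF c])
  show "is_map Z (Pob Q X) (mate Q \<phi> \<cdot> f)"
    by (rule is_map_comp[OF f is_map_mate[OF \<phi>]])
  show "app (mate Q (cograph Q f \<odot>\<^bsub>Q\<^esub> \<phi>)) z = app (mate Q \<phi> \<cdot> f) z" if "z \<in> pts Z" for z
    using that f by (auto simp: app_mate[OF c] app_comp[OF f] app_mate[OF \<phi>] is_mapD
        rval_cograph_comp[OF f \<phi>] intro: fam_cong)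
qed

lemma mate_identity: "X \<in> slice_obs Q \<Longrightarrow> mate Q (cograph Q (map_id X)) = yon Q X"
  unfolding mate_def yon_def cograph_def map_id_def
  by (auto intro!: fam_cong restrict_ext)

lemma is_rel_eps: "X \<in> slice_obs Q \<Longrightarrow> is_rel X (Pob Q X) (eps Q X)"
  by (auto simp: is_rel_def qrels_def eps_def Pob_in Pob_decode arr_Pob)

lemma mate_eps:
  assumes X: "X \<in> slice_obs Q"
  shows "mate Q (eps Q X) = map_id (Pob Q X)"
proof (rule map_eqI[of "Pob Q X" "Pob Q X"])
  show "app (mate Q (eps Q X)) \<sigma> = app (map_id (Pob Q X)) \<sigma>" if s: "\<sigma> \<in> pts (Pob Q X)" for \<sigma>
  proof -
    have "app (mate Q (eps Q X)) \<sigma> = fam X (fam_cod \<sigma>) (fam_at \<sigma>)"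
      unfolding app_mate[OF is_rel_eps[OF X] s] arr_Pob[OF s]
      using s by (auto intro: fam_cong simp: eps_def)
    then show ?thesis
      using Pob_decode(3)[OF X s] s by (simp add: map_id_def)
  qed
qed (use X in \<open>auto intro: is_map_mate is_rel_eps is_map_id Pob_in\<close>)

text \<open>
  The relation \<open>eps Q X\<close> is universal: its mate is the identity, so that substituting \<open>g\<close> into it
  produces a relation with mate \<open>g\<close>. This spares an explicit inverse of \<open>mate\<close>.
\<close>

lemma mate_surj:
  assumes g: "is_map Y (Pob Q X) g" and X: "X \<in> slice_obs Q"
  obtains \<phi> where "is_rel X Y \<phi>" "mate Q \<phi> = g"
proof
  show "is_rel X Y (cograph Q g \<odot>\<^bsub>Q\<^esub> eps Q X)"
    by (rule is_rel_comp[OF is_rel_eps[OF X] is_rel_cograph[OF g]])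
  show "mate Q (cograph Q g \<odot>\<^bsub>Q\<^esub> eps Q X) = g"
    using mate_cograph_comp[OF g is_rel_eps[OF X]] mate_eps[OF X] map_id_left[OF g] by simp
qed

lemma rel_via_eps:
  assumes \<phi>: "is_rel X Y \<phi>"
  shows "cograph Q (mate Q \<phi>) \<odot>\<^bsub>Q\<^esub> eps Q X = \<phi>"
proof (rule mate_inject)
  note X = is_relD(1)[OF \<phi>]
  show "is_rel X Y (cograph Q (mate Q \<phi>) \<odot>\<^bsub>Q\<^esub> eps Q X)"
    by (rule is_rel_comp[OF is_rel_eps[OF X] is_rel_cograph[OF is_map_mate[OF \<phi>]]])
  show "mate Q (cograph Q (mate Q \<phi>) \<odot>\<^bsub>Q\<^esub> eps Q X) = mate Q \<phi>"
    using mate_cograph_comp[OF is_map_mate[OF \<phi>] is_rel_eps[OF X]] mate_eps[OF X]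
      map_id_left[OF is_map_mate[OF \<phi>]] by simp
qed (rule \<phi>)

lemma is_map_Pmap:
  assumes f: "is_map X Y f"
  shows "is_map (Pob Q X) (Pob Q Y) (Pmap Q f)"
proof -
  note ob = is_mapD(1,2)[OF f]
  have "fam Y (fam_cod \<sigma>) (\<lambda>y. Join (arr Y y) (fam_cod \<sigma>) (fam_at \<sigma> ` {x \<in> pts X. app f x = y}))
      \<in> pts (Pob Q Y)" if s: "\<sigma> \<in> pts (Pob Q X)" for \<sigma>
  proof (intro fam_in_Pob Join_in)
    fix y assume "y \<in> pts Y"
    show "fam_at \<sigma> ` {x \<in> pts X. app f x = y} \<subseteq> Hom Q (arr Y y) (fam_cod \<sigma>)"
      using Pob_decode(2)[OF ob(1) s] is_mapD(7)[OF f] by auto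
  qed (use ob Pob_decode(1)[OF ob(1) s] in auto)
  then show ?thesis
    using f by (auto simp: is_map_def slice_maps_def Pmap_def Pob_in arr_Pob)
qed

lemma mate_comp_cograph:
  assumes f: "is_map X Y f" and \<psi>: "is_rel X Z \<psi>"
  shows "mate Q (\<psi> \<odot>\<^bsub>Q\<^esub> cograph Q f) = Pmap Q f \<cdot> mate Q \<psi>"
proof (rule map_eqI[of Z "Pob Q Y"])
  note c = is_rel_comp[OF is_rel_cograph[OF f] \<psi>]
  note m = is_map_mate[OF \<psi>]
  show "is_map Z (Pob Q Y) (mate Q (\<psi> \<odot>\<^bsub>Q\<^esub> cograph Q f))"
    by (rule is_map_mate[OF c])
  show "is_map Z (Pob Q Y) (Pmap Q f \<cdot> mate Q \<psi>)"
    by (rule is_map_comp[OF m is_map_Pmap[OF f]])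
  fix z assume z: "z \<in> pts Z"
  let ?\<sigma> = "fam X (arr Z z) (\<lambda>x. rval \<psi> x z)"
  have s: "?\<sigma> \<in> pts (Pob Q X)"
    using is_mapD(6)[OF m z] by (simp add: app_mate[OF \<psi> z])
  have im: "fam_at ?\<sigma> ` {x \<in> pts X. app f x = y} = (\<lambda>x. rval \<psi> x z) ` {x \<in> pts X. app f x = y}" for y
    by (rule image_cong) (auto simp: is_relD(1)[OF \<psi>])
  have "app (Pmap Q f \<cdot> mate Q \<psi>) z
      = fam Y (arr Z z) (\<lambda>y. Join (arr Y y) (arr Z z) ((\<lambda>x. rval \<psi> x z) ` {x \<in> pts X. app f x = y}))"
    using s by (simp add: app_comp[OF m z] app_mate[OF \<psi> z] Pmap_def is_mapD(3,4)[OF f] im)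
  then show "app (mate Q (\<psi> \<odot>\<^bsub>Q\<^esub> cograph Q f)) z = app (Pmap Q f \<cdot> mate Q \<psi>) z"
    by (auto simp: app_mate[OF c z] rval_comp_cograph[OF f \<psi> _ z] intro: fam_cong)
qed

text \<open>
  Functoriality of \<open>P\<close> is that of cographs, read off at the relation whose mate is the identity.
\<close>

lemma Pmap_comp:
  assumes f: "is_map X Y f" and g: "is_map Y Z g"
  shows "Pmap Q (g \<cdot> f) = Pmap Q g \<cdot> Pmap Q f"
proof -
  note X = is_mapD(1)[OF f] note E = is_rel_eps[OF X]
  have "Pmap Q (g \<cdot> f) = Pmap Q (g \<cdot> f) \<cdot> mate Q (eps Q X)"
    by (simp add: mate_eps[OF X] map_id_right[OF is_map_Pmap[OF is_map_comp[OF f g]]])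
  also have "\<dots> = mate Q (eps Q X \<odot>\<^bsub>Q\<^esub> cograph Q f \<odot>\<^bsub>Q\<^esub> cograph Q g)"
    by (simp add: mate_comp_cograph[OF is_map_comp[OF f g] E, symmetric] cograph_comp[OF f g])
  also have "\<dots> = mate Q ((eps Q X \<odot>\<^bsub>Q\<^esub> cograph Q f) \<odot>\<^bsub>Q\<^esub> cograph Q g)"
    by (simp add: rel_comp_assoc[OF is_rel_cograph[OF g] is_rel_cograph[OF f] E])
  also have "\<dots> = Pmap Q g \<cdot> Pmap Q f \<cdot> mate Q (eps Q X)"
    by (simp add: mate_comp_cograph[OF g is_rel_comp[OF is_rel_cograph[OF f] E]]
        mate_comp_cograph[OF f E])
  finally show ?thesis
    by (simp add: mate_eps[OF X] map_id_right[OF is_map_Pmap[OF f]])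
qed

lemma is_map_psup:
  assumes X: "X \<in> slice_obs Q"
  shows "is_map (Pob Q (Pob Q X)) (Pob Q X) (psup Q X)"
proof -
  note PX = Pob_in[OF X]
  have "fam X (fam_cod \<Sigma>) (\<lambda>x. Join (arr X x) (fam_cod \<Sigma>)
      ((\<lambda>\<sigma>. Comp Q (fam_at \<Sigma> \<sigma>) (fam_at \<sigma> x)) ` pts (Pob Q X))) \<in> pts (Pob Q X)"
    if S: "\<Sigma> \<in> pts (Pob Q (Pob Q X))" for \<Sigma>
  proof (intro fam_in_Pob Join_in image_subsetI)
    fix x \<sigma> assume x: "x \<in> pts X" and s: "\<sigma> \<in> pts (Pob Q X)"
    show "Comp Q (fam_at \<Sigma> \<sigma>) (fam_at \<sigma> x) \<in> Hom Q (arr X x) (fam_cod \<Sigma>)"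
      using Pob_decode[OF X s] Pob_decode(1,2)[OF PX S] x s X
      by (intro Comp_in[of _ _ "fam_cod \<sigma>"]) (auto simp: arr_Pob)
  qed (use X Pob_decode(1)[OF PX S] in auto)
  then show ?thesis
    using X by (auto simp: is_map_def slice_maps_def psup_def Pob_in arr_Pob)
qed

text \<open>
  The multiplication of the presheaf monad is the special case \<open>\<phi> = eps Q X\<close> of Kleisli
  composition, because \<open>eps Q X\<close> is the evaluation of families.
\<close>

lemma psup_mate:
  assumes X: "X \<in> slice_obs Q" and \<chi>: "is_rel (Pob Q X) Z \<chi>"
  shows "psup Q X \<cdot> mate Q \<chi> = mate Q (\<chi> \<odot>\<^bsub>Q\<^esub> eps Q X)"
proof (rule map_eqI[of Z "Pob Q X"])
  note E = is_rel_eps[OF X] note c = is_rel_comp[OF E \<chi>]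
  note m = is_map_mate[OF \<chi>]
  show "is_map Z (Pob Q X) (psup Q X \<cdot> mate Q \<chi>)"
    by (rule is_map_comp[OF m is_map_psup[OF X]])
  show "is_map Z (Pob Q X) (mate Q (\<chi> \<odot>\<^bsub>Q\<^esub> eps Q X))"
    by (rule is_map_mate[OF c])
  fix z assume z: "z \<in> pts Z"
  let ?S = "fam (Pob Q X) (arr Z z) (\<lambda>\<sigma>. rval \<chi> \<sigma> z)"
  have S: "?S \<in> pts (Pob Q (Pob Q X))"
    using is_mapD(6)[OF m z] by (simp add: app_mate[OF \<chi> z])
  have im: "(\<lambda>\<sigma>. Comp Q (fam_at ?S \<sigma>) (fam_at \<sigma> x)) ` pts (Pob Q X)
      = (\<lambda>\<sigma>. Comp Q (rval \<chi> \<sigma> z) (rval (eps Q X) x \<sigma>)) ` pts (Pob Q X)" if "x \<in> pts X" for x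
    using that by (intro image_cong) (auto simp: eps_def small_Pob[OF X])
  show "app (psup Q X \<cdot> mate Q \<chi>) z = app (mate Q (\<chi> \<odot>\<^bsub>Q\<^esub> eps Q X)) z"
    using S by (auto simp: app_comp[OF m z] app_mate[OF \<chi> z] app_mate[OF c z] psup_def
        rval_comp[OF E \<chi> _ z] im intro: fam_cong)
qed

text \<open>
  The general case reduces to \<open>eps Q X\<close>: every \<open>\<phi>\<close> is \<open>eps Q X\<close> followed by the cograph of its
  mate, and that cograph can be absorbed into \<open>\<psi>\<close>.
\<close>

lemma mate_comp:
  assumes \<phi>: "is_rel X Y \<phi>" and \<psi>: "is_rel Y Z \<psi>"
  shows "mate Q (\<psi> \<odot>\<^bsub>Q\<^esub> \<phi>) = psup Q X \<cdot> Pmap Q (mate Q \<phi>) \<cdot> mate Q \<psi>"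
proof -
  note X = is_relD(1)[OF \<phi>] note E = is_rel_eps[OF X]
  note m = is_map_mate[OF \<phi>] note co = is_rel_cograph[OF m]
  have "psup Q X \<cdot> Pmap Q (mate Q \<phi>) \<cdot> mate Q \<psi> = psup Q X \<cdot> mate Q (\<psi> \<odot>\<^bsub>Q\<^esub> cograph Q (mate Q \<phi>))"
    by (simp add: mate_comp_cograph[OF m \<psi>])
  also have "\<dots> = mate Q (\<psi> \<odot>\<^bsub>Q\<^esub> cograph Q (mate Q \<phi>) \<odot>\<^bsub>Q\<^esub> eps Q X)"
    by (simp add: psup_mate[OF X is_rel_comp[OF co \<psi>]] rel_comp_assoc[OF E co \<psi>])
  finally show ?thesis
    by (simp add: rel_via_eps[OF \<phi>])
qed

end


section \<open>Transport along a bijection on objects\<close>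

text \<open>
  An isomorphism of categories which is the identity on arrows, given by its action on objects.
  Passing to mates is of this kind, so the categories of algebras on maps inherit all
  their structure from those on relations.
\<close>

definition relabelling ::
  "('o, 'm) category \<Rightarrow> ('p, 'm) category \<Rightarrow> ('o \<Rightarrow> 'p) \<Rightarrow> bool" where
  "relabelling C D F \<longleftrightarrow> bij_betw F (Ob C) (Ob D) \<and>
     (\<forall>a\<in>Ob C. \<forall>b\<in>Ob C. Hom D (F a) (F b) = Hom C a b) \<and>
     Comp D = Comp C \<and> (\<forall>a\<in>Ob C. Ide D (F a) = Ide C a)"

lemma relabelling_Ob: "relabelling C D F \<Longrightarrow> Ob D = F ` Ob C"
  by (simp add: relabelling_def bij_betw_def)

lemma is_category_relabelling:
  assumes "relabelling C D F" "is_category C"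
  shows "is_category D"
  using assms unfolding is_category_def relabelling_Ob[OF assms(1)] ball_simps
  by (simp add: relabelling_def)

lemma is_functor_identity_on_arrows:
  assumes "is_category C" "is_category D" and "\<And>a. a \<in> Ob C \<Longrightarrow> F a \<in> Ob D"
    and "\<And>a b. a \<in> Ob C \<Longrightarrow> b \<in> Ob C \<Longrightarrow> Hom C a b \<subseteq> Hom D (F a) (F b)"
    and "Comp D = Comp C" and "\<And>a. a \<in> Ob C \<Longrightarrow> Ide D (F a) = Ide C a"
  shows "is_functor C D \<lparr>fob = F, farr = (\<lambda>_ _ f. f)\<rparr>"
  using assms unfolding is_functor_def by auto

lemma is_iso_functor_relabelling:
  assumes rel: "relabelling C D F" and C: "is_category C"
  shows "is_iso_functor C D \<lparr>fob = F, farr = (\<lambda>_ _ f. f)\<rparr>"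
proof -
  note D = is_category_relabelling[OF rel C]
  let ?G = "inv_into (Ob C) F"
  have bij: "bij_betw F (Ob C) (Ob D)"
    using rel by (simp add: relabelling_def)
  have G: "?G b \<in> Ob C" "F (?G b) = b" if "b \<in> Ob D" for b
    using that bij bij_betw_inv_into_right inv_into_into[of b F "Ob C"]
    by (auto simp: bij_betw_def f_inv_into_f)
  have GF: "?G (F a) = a" if "a \<in> Ob C" for a
    using that bij by (simp add: bij_betw_inv_into_left)
  have "is_functor C D \<lparr>fob = F, farr = (\<lambda>_ _ f. f)\<rparr>"
    using rel C D by (intro is_functor_identity_on_arrows) (auto simp: relabelling_def bij_betw_def)
  moreover have "is_functor D C \<lparr>fob = ?G, farr = (\<lambda>_ _ f. f)\<rparr>"
  proof (rule is_functor_identity_on_arrows[OF D C])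
    show "Hom D a b \<subseteq> Hom C (?G a) (?G b)" if "a \<in> Ob D" "b \<in> Ob D" for a b
      using rel G[OF that(1)] G[OF that(2)] unfolding relabelling_def by (metis order_refl)
    show "Ide C (?G a) = Ide D a" if "a \<in> Ob D" for a
      using rel G[OF that] unfolding relabelling_def by metis
  qed (use rel G in \<open>auto simp: relabelling_def\<close>)
  ultimately show ?thesis
    unfolding is_iso_functor_def
    by (intro conjI exI[of _ "\<lparr>fob = ?G, farr = (\<lambda>_ _ f. f)\<rparr>"])
      (auto simp: functors_equal_def functor_comp_def functor_id_def G GF)
qed

text \<open>
  On objects \<open>L\<close> is the conjugate of \<open>K\<close> by the two relabellings, and nothing happens to arrows.
\<close>

lemma is_functor_relabelling:
  assumes C: "relabelling C C' F" and D: "relabelling D D' G"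
    and K: "is_functor C D \<lparr>fob = K, farr = (\<lambda>_ _ f. f)\<rparr>"
    and comp: "Comp D = Comp C"
    and L: "\<And>a. a \<in> Ob C \<Longrightarrow> L (F a) = G (K a)"
  shows "is_functor C' D' \<lparr>fob = L, farr = (\<lambda>_ _ f. f)\<rparr>"
proof -
  have cat: "is_category C" "is_category D"
    using K by (simp_all add: is_functor_def)
  have K_ob: "K a \<in> Ob D" if "a \<in> Ob C" for a
    using K that by (simp add: is_functor_def)
  have K_hom: "f \<in> Hom D (K a) (K b)" if "a \<in> Ob C" "b \<in> Ob C" "f \<in> Hom C a b" for a b f
    using K that by (simp add: is_functor_def)
  have K_ide: "Ide D (K a) = Ide C a" if "a \<in> Ob C" for a
    using K that by (simp add: is_functor_def)
  show ?thesis
  proof (rule is_functor_identity_on_arrows[OF is_category_relabelling[OF C cat(1)]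
        is_category_relabelling[OF D cat(2)]])
  qed (use C D comp L K_ob K_ide in
      \<open>auto simp: relabelling_Ob[OF C] relabelling_def bij_betw_def intro: K_hom\<close>)
qed


section \<open>Lax algebras for a monad with a lax extension\<close>

locale lax_extended_monad = base_quantaloid Q
  for Q :: "('u::universe, 'u) quantaloid" +
  fixes T :: "'u slice_monad"
    and lam :: "'u slice_ob \<Rightarrow> 'u slice_map"
    and That :: "'u qrel \<Rightarrow> 'u qrel"
  assumes monad: "is_monad Q T"
    and lax_extension: "lax_extension Q T That"
    and corresponding: "corresponding Q T lam That"
begin

lemma T_functor: "is_functor (slice Q) (slice Q) T"
  using monad by (simp add: is_monad_def)

lemma T_ob: "X \<in> slice_obs Q \<Longrightarrow> fob T X \<in> slice_obs Q"
  using T_functor by (simp add: is_functor_def slice_def)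

lemma is_map_fmap: "is_map X Y f \<Longrightarrow> is_map (fob T X) (fob T Y) (fmap T f)"
  using T_functor is_mapD(3,4)[of X Y f] by (simp add: is_functor_def slice_def is_map_def fmap_def)

lemma fmap_comp:
  assumes f: "is_map X Y f" and g: "is_map Y Z g"
  shows "fmap T (g \<cdot> f) = fmap T g \<cdot> fmap T f"
proof -
  have "farr T X Z (g \<cdot> f) = farr T Y Z g \<cdot> farr T X Y f"
    using T_functor f g unfolding is_functor_def slice_def is_map_def by simp
  then show ?thesis
    using f g is_map_comp[OF f g] by (simp add: fmap_def is_mapD(3,4))
qed

lemma fmap_id: "X \<in> slice_obs Q \<Longrightarrow> fmap T (map_id X) = map_id (fob T X)"
  using T_functor by (simp add: is_functor_def slice_def fmap_def map_id_def)

lemma is_map_eta: "X \<in> slice_obs Q \<Longrightarrow> is_map X (fob T X) (eta T X)"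
  and is_map_mult: "X \<in> slice_obs Q \<Longrightarrow> is_map (fob T (fob T X)) (fob T X) (mult T X)"
  using monad T_ob by (simp_all add: is_monad_def is_map_def)

lemma is_rel_That: "is_rel X Y \<phi> \<Longrightarrow> is_rel (fob T X) (fob T Y) (That \<phi>)"
  using lax_extension by (simp add: lax_extension_def is_rel_def T_ob)

lemma mate_That: "is_rel X Y \<phi> \<Longrightarrow> mate Q (That \<phi>) = lam X \<cdot> fmap T (mate Q \<phi>)"
  using corresponding unfolding corresponding_def is_rel_def by blast

lemma is_map_lam: "X \<in> slice_obs Q \<Longrightarrow> is_map (fob T (Pob Q X)) (Pob Q (fob T X)) (lam X)"
  using corresponding is_map_mate[OF is_rel_That[OF is_rel_eps]] by (simp add: corresponding_def)

lemma lax_cat_Ob_iff: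
  "(X, \<alpha>) \<in> Ob (lax_cat Q T That) \<longleftrightarrow> is_rel X (fob T X) \<alpha> \<and>
     cograph Q (map_id X) \<preceq>\<^bsub>Q\<^esub> cograph Q (eta T X) \<odot>\<^bsub>Q\<^esub> \<alpha> \<and>
     That \<alpha> \<odot>\<^bsub>Q\<^esub> \<alpha> \<preceq>\<^bsub>Q\<^esub> cograph Q (mult T X) \<odot>\<^bsub>Q\<^esub> \<alpha>"
  using T_ob by (auto simp: lax_cat_def is_rel_def)

lemma dist_alg_Ob_iff:
  "(X, p) \<in> Ob (dist_alg Q T lam) \<longleftrightarrow> X \<in> slice_obs Q \<and> is_map (fob T X) (Pob Q X) p \<and>
     yon Q X \<lesssim>\<^bsub>Q,X\<^esub> p \<cdot> eta T X \<and>
     psup Q X \<cdot> Pmap Q p \<cdot> lam X \<cdot> fmap T p \<lesssim>\<^bsub>Q,X\<^esub> p \<cdot> mult T X"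
  using T_ob Pob_in by (auto simp: dist_alg_def is_map_def)

lemma lax_cat_Hom_iff:
  assumes "X \<in> slice_obs Q" "Y \<in> slice_obs Q"
  shows "f \<in> Hom (lax_cat Q T That) (X, \<alpha>) (Y, \<beta>) \<longleftrightarrow> is_map X Y f \<and>
    \<alpha> \<odot>\<^bsub>Q\<^esub> cograph Q f \<preceq>\<^bsub>Q\<^esub> cograph Q (fmap T f) \<odot>\<^bsub>Q\<^esub> \<beta>"
  using assms by (simp add: lax_cat_def is_map_def)

text \<open>
  The two lax squares are pasted along \<open>\<beta>\<close>; forming cographs reverses composition, which turns
  the outer edges into the cographs of \<open>g \<cdot> f\<close> and of its image under \<open>T\<close>.
\<close>

lemma lax_cat_Hom_comp:
  assumes \<alpha>: "is_rel X (fob T X) \<alpha>" and \<beta>: "is_rel Y (fob T Y) \<beta>" and \<gamma>: "is_rel Z (fob T Z) \<gamma>"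
    and f: "f \<in> Hom (lax_cat Q T That) (X, \<alpha>) (Y, \<beta>)"
    and g: "g \<in> Hom (lax_cat Q T That) (Y, \<beta>) (Z, \<gamma>)"
  shows "g \<cdot> f \<in> Hom (lax_cat Q T That) (X, \<alpha>) (Z, \<gamma>)"
proof -
  note ob = is_relD(1)[OF \<alpha>] is_relD(1)[OF \<beta>] is_relD(1)[OF \<gamma>]
  have mf: "is_map X Y f" and lef: "\<alpha> \<odot>\<^bsub>Q\<^esub> cograph Q f \<preceq>\<^bsub>Q\<^esub> cograph Q (fmap T f) \<odot>\<^bsub>Q\<^esub> \<beta>"
    using f ob by (simp_all add: lax_cat_Hom_iff)
  have mg: "is_map Y Z g" and leg: "\<beta> \<odot>\<^bsub>Q\<^esub> cograph Q g \<preceq>\<^bsub>Q\<^esub> cograph Q (fmap T g) \<odot>\<^bsub>Q\<^esub> \<gamma>"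
    using g ob by (simp_all add: lax_cat_Hom_iff)
  note cf = is_rel_cograph[OF mf] and cg = is_rel_cograph[OF mg]
  note cTf = is_rel_cograph[OF is_map_fmap[OF mf]] and cTg = is_rel_cograph[OF is_map_fmap[OF mg]]
  note typing = is_rel_comp[OF cf \<alpha>] is_rel_comp[OF \<beta> cTf] is_rel_comp[OF cg \<beta>] is_rel_comp[OF \<gamma> cTg]
  have 1: "(\<alpha> \<odot>\<^bsub>Q\<^esub> cograph Q f) \<odot>\<^bsub>Q\<^esub> cograph Q g \<preceq>\<^bsub>Q\<^esub> (cograph Q (fmap T f) \<odot>\<^bsub>Q\<^esub> \<beta>) \<odot>\<^bsub>Q\<^esub> cograph Q g"
    by (rule rel_comp_mono_left[OF lef cg typing(1,2)])
  have 2: "cograph Q (fmap T f) \<odot>\<^bsub>Q\<^esub> \<beta> \<odot>\<^bsub>Q\<^esub> cograph Q g \<preceq>\<^bsub>Q\<^esub> cograph Q (fmap T f) \<odot>\<^bsub>Q\<^esub> cograph Q (fmap T g) \<odot>\<^bsub>Q\<^esub> \<gamma>"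
    by (rule rel_comp_mono_right[OF leg typing(3,4) cTf])
  have "\<alpha> \<odot>\<^bsub>Q\<^esub> cograph Q f \<odot>\<^bsub>Q\<^esub> cograph Q g \<preceq>\<^bsub>Q\<^esub> cograph Q (fmap T f) \<odot>\<^bsub>Q\<^esub> cograph Q (fmap T g) \<odot>\<^bsub>Q\<^esub> \<gamma>"
    using rel_le_trans[OF 1[unfolded rel_comp_assoc[OF cg cf \<alpha>] rel_comp_assoc[OF cg \<beta> cTf]] 2]
    by (meson is_rel_comp cf cg \<alpha> \<beta> \<gamma> cTf cTg)
  then show ?thesis
    using ob mf mg
    by (simp add: lax_cat_Hom_iff is_map_comp[OF mf mg] cograph_comp[OF mf mg] fmap_comp[OF mf mg]
        cograph_comp[OF is_map_fmap[OF mf] is_map_fmap[OF mg]] rel_comp_assoc[OF \<gamma> cTg cTf])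
qed

lemma lax_cat_is_category: "is_category (lax_cat Q T That)"
proof -
  let ?C = "lax_cat Q T That"
  have map: "is_map X Y f" if "f \<in> Hom ?C (X, \<alpha>) (Y, \<beta>)" "(X, \<alpha>) \<in> Ob ?C" "(Y, \<beta>) \<in> Ob ?C" for X Y \<alpha> \<beta> f
    using that by (auto simp: lax_cat_Hom_iff lax_cat_Ob_iff is_relD)
  have "map_id X \<in> Hom ?C (X, \<alpha>) (X, \<alpha>)" if a: "(X, \<alpha>) \<in> Ob ?C" for X \<alpha>
  proof -
    have r: "is_rel X (fob T X) \<alpha>"
      using a by (simp add: lax_cat_Ob_iff)
    note X = is_relD(1)[OF r]
    show ?thesis
      using X rel_le_refl[OF r]
      by (simp add: lax_cat_Hom_iff is_map_id fmap_id comp_cograph_id[OF r] cograph_id_comp[OF r])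
  qed
  moreover have "g \<cdot> f \<in> Hom ?C (X, \<alpha>) (Z, \<gamma>)"
    if "(X, \<alpha>) \<in> Ob ?C" "(Y, \<beta>) \<in> Ob ?C" "(Z, \<gamma>) \<in> Ob ?C" "f \<in> Hom ?C (X, \<alpha>) (Y, \<beta>)"
      "g \<in> Hom ?C (Y, \<beta>) (Z, \<gamma>)" for X \<alpha> Y \<beta> Z \<gamma> f g
    using that lax_cat_Hom_comp by (meson lax_cat_Ob_iff)
  moreover have "f \<cdot> map_id X = f \<and> map_id Y \<cdot> f = f"
    if "(X, \<alpha>) \<in> Ob ?C" "(Y, \<beta>) \<in> Ob ?C" "f \<in> Hom ?C (X, \<alpha>) (Y, \<beta>)" for X \<alpha> Y \<beta> f
    using map[OF that(3,1,2)] by (simp add: map_id_left map_id_right)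
  moreover have "h \<cdot> g \<cdot> f = (h \<cdot> g) \<cdot> f"
    if "(X, \<alpha>) \<in> Ob ?C" "(Y, \<beta>) \<in> Ob ?C" "(Z, \<gamma>) \<in> Ob ?C" "(W, \<delta>) \<in> Ob ?C"
      "f \<in> Hom ?C (X, \<alpha>) (Y, \<beta>)" "g \<in> Hom ?C (Y, \<beta>) (Z, \<gamma>)" "h \<in> Hom ?C (Z, \<gamma>) (W, \<delta>)"
    for X \<alpha> Y \<beta> Z \<gamma> W \<delta> f g h
    using map_comp_assoc[OF map[OF that(5,1,2)] map[OF that(6,2,3)] map[OF that(7,3,4)]] by simp
  moreover have "Comp ?C = (\<cdot>)" "\<And>X \<alpha>. Ide ?C (X, \<alpha>) = map_id X"
    by (simp_all add: lax_cat_def)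
  ultimately show ?thesis
    unfolding is_category_def by (intro conjI ballI; clarsimp)
qed

lemma mate_Ob_iff:
  assumes r: "is_rel X (fob T X) \<alpha>"
  shows "(X, mate Q \<alpha>) \<in> Ob (dist_alg Q T lam) \<longleftrightarrow> (X, \<alpha>) \<in> Ob (lax_cat Q T That)"
proof -
  note X = is_relD(1)[OF r]
  note e = is_map_eta[OF X] and m = is_map_mult[OF X] and i = is_map_id[OF X]
  have "yon Q X \<lesssim>\<^bsub>Q,X\<^esub> mate Q \<alpha> \<cdot> eta T X
      \<longleftrightarrow> cograph Q (map_id X) \<preceq>\<^bsub>Q\<^esub> cograph Q (eta T X) \<odot>\<^bsub>Q\<^esub> \<alpha>"
    using mate_le_iff[OF is_rel_cograph[OF i] is_rel_comp[OF r is_rel_cograph[OF e]]]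
    by (simp add: mate_identity[OF X] mate_cograph_comp[OF e r])
  moreover have "psup Q X \<cdot> Pmap Q (mate Q \<alpha>) \<cdot> lam X \<cdot> fmap T (mate Q \<alpha>) \<lesssim>\<^bsub>Q,X\<^esub> mate Q \<alpha> \<cdot> mult T X
      \<longleftrightarrow> That \<alpha> \<odot>\<^bsub>Q\<^esub> \<alpha> \<preceq>\<^bsub>Q\<^esub> cograph Q (mult T X) \<odot>\<^bsub>Q\<^esub> \<alpha>"
    using mate_le_iff[OF is_rel_comp[OF r is_rel_That[OF r]] is_rel_comp[OF r is_rel_cograph[OF m]]]
    by (simp add: mate_comp[OF r is_rel_That[OF r]] mate_That[OF r] mate_cograph_comp[OF m r])
  ultimately show ?thesis
    using X r is_map_mate[OF r] by (simp add: lax_cat_Ob_iff dist_alg_Ob_iff)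
qed

lemma mate_Hom_iff:
  assumes \<alpha>: "is_rel X (fob T X) \<alpha>" and \<beta>: "is_rel Y (fob T Y) \<beta>"
  shows "f \<in> Hom (dist_alg Q T lam) (X, mate Q \<alpha>) (Y, mate Q \<beta>)
    \<longleftrightarrow> f \<in> Hom (lax_cat Q T That) (X, \<alpha>) (Y, \<beta>)"
proof (cases "is_map X Y f")
  case f: True
  note Tf = is_map_fmap[OF f]
  have "Pmap Q f \<cdot> mate Q \<alpha> \<lesssim>\<^bsub>Q,Y\<^esub> mate Q \<beta> \<cdot> fmap T f
      \<longleftrightarrow> \<alpha> \<odot>\<^bsub>Q\<^esub> cograph Q f \<preceq>\<^bsub>Q\<^esub> cograph Q (fmap T f) \<odot>\<^bsub>Q\<^esub> \<beta>"
    using mate_le_iff[OF is_rel_comp[OF is_rel_cograph[OF f] \<alpha>] is_rel_comp[OF \<beta> is_rel_cograph[OF Tf]]]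
    by (simp add: mate_comp_cograph[OF f \<alpha>] mate_cograph_comp[OF Tf \<beta>])
  then show ?thesis
    using f by (simp add: dist_alg_def lax_cat_def)
next
  case False
  then show ?thesis
    using is_relD(1)[OF \<alpha>] is_relD(1)[OF \<beta>] by (simp add: dist_alg_def lax_cat_def is_map_def)
qed

text \<open>
  The axioms for objects and for morphisms are mates of each other (\<open>mate_Ob_iff\<close>,
  \<open>mate_Hom_iff\<close>), and every structure map into a presheaf object is a mate.
\<close>

lemma mate_relabelling:
  "relabelling (lax_cat Q T That) (dist_alg Q T lam) (\<lambda>(X, \<alpha>). (X, mate Q \<alpha>))"
proof -
  let ?C = "lax_cat Q T That" and ?D = "dist_alg Q T lam" and ?F = "\<lambda>(X, \<alpha>). (X, mate Q \<alpha>)"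
  have r: "is_rel X (fob T X) \<alpha>" if "(X, \<alpha>) \<in> Ob ?C" for X \<alpha>
    using that by (simp add: lax_cat_Ob_iff)
  have "inj_on ?F (Ob ?C)"
    by (rule inj_onI) (auto dest!: r intro: mate_inject)
  moreover have "?F ` Ob ?C = Ob ?D"
  proof (intro equalityI subsetI)
    fix b assume "b \<in> ?F ` Ob ?C"
    then show "b \<in> Ob ?D"
      using r mate_Ob_iff by auto
  next
    fix b assume b: "b \<in> Ob ?D"
    obtain X p where b': "b = (X, p)"
      by (cases b)
    then have p: "is_map (fob T X) (Pob Q X) p" and X: "X \<in> slice_obs Q"
      using b by (simp_all add: dist_alg_Ob_iff)
    obtain \<alpha> where \<alpha>: "is_rel X (fob T X) \<alpha>" "mate Q \<alpha> = p"
      by (rule mate_surj[OF p X])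
    then have "(X, \<alpha>) \<in> Ob ?C"
      using b b' mate_Ob_iff[OF \<alpha>(1)] by simp
    then show "b \<in> ?F ` Ob ?C"
      using b' \<alpha>(2) by force
  qed
  moreover have "Hom ?D (?F a) (?F b) = Hom ?C a b" if "a \<in> Ob ?C" "b \<in> Ob ?C" for a b
    using that r mate_Hom_iff by (cases a; cases b) (simp add: set_eq_iff)
  ultimately show ?thesis
    unfolding relabelling_def bij_betw_def by (auto simp: lax_cat_def dist_alg_def)
qed

lemma mate_iso_functor: "is_iso_functor (lax_cat Q T That) (dist_alg Q T lam) (mate_functor Q)"
  unfolding mate_functor_def
  by (rule is_iso_functor_relabelling[OF mate_relabelling lax_cat_is_category])

end


section \<open>Algebraic morphisms\<close>

locale algebraic_morphism = base_quantaloid Q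
  + T: lax_extended_monad Q T lam That + S: lax_extended_monad Q S kap Shat
  for Q :: "('u::universe, 'u) quantaloid"
    and T lam That S kap Shat +
  fixes h :: "'u slice_ob \<Rightarrow> 'u qrel"
  assumes lax_algebraic_morphism: "lax_algebraic_morphism Q T That S Shat h"
begin

lemma is_rel_h: "X \<in> slice_obs Q \<Longrightarrow> is_rel (fob T X) (fob S X) (h X)"
  using lax_algebraic_morphism by (simp add: lax_algebraic_morphism_def is_rel_def T.T_ob S.T_ob)

lemma h_natural: "is_map X Y f \<Longrightarrow>
    h X \<odot>\<^bsub>Q\<^esub> cograph Q (fmap T f) \<preceq>\<^bsub>Q\<^esub> cograph Q (fmap S f) \<odot>\<^bsub>Q\<^esub> h Y"
  and h_unit: "X \<in> slice_obs Q \<Longrightarrow>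
    cograph Q (eta T X) \<preceq>\<^bsub>Q\<^esub> cograph Q (eta S X) \<odot>\<^bsub>Q\<^esub> h X"
  and h_mult: "X \<in> slice_obs Q \<Longrightarrow>
    Shat (h X) \<odot>\<^bsub>Q\<^esub> h (fob T X) \<odot>\<^bsub>Q\<^esub> cograph Q (mult T X) \<preceq>\<^bsub>Q\<^esub> cograph Q (mult S X) \<odot>\<^bsub>Q\<^esub> h X"
  and h_extension: "is_rel X Y \<phi> \<Longrightarrow> Shat \<phi> \<odot>\<^bsub>Q\<^esub> h X \<preceq>\<^bsub>Q\<^esub> h Y \<odot>\<^bsub>Q\<^esub> That \<phi>"
  and h_comp: "is_rel X (fob T X) \<alpha> \<Longrightarrow>
    Shat (h X \<odot>\<^bsub>Q\<^esub> \<alpha>) \<preceq>\<^bsub>Q\<^esub> Shat (h X) \<odot>\<^bsub>Q\<^esub> Shat \<alpha>"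
  using lax_algebraic_morphism by (simp_all add: lax_algebraic_morphism_def is_rel_def is_map_def)

lemma algebraic_functor_unit:
  assumes r: "is_rel X (fob T X) \<alpha>"
    and u: "cograph Q (map_id X) \<preceq>\<^bsub>Q\<^esub> cograph Q (eta T X) \<odot>\<^bsub>Q\<^esub> \<alpha>"
  shows "cograph Q (map_id X) \<preceq>\<^bsub>Q\<^esub> cograph Q (eta S X) \<odot>\<^bsub>Q\<^esub> h X \<odot>\<^bsub>Q\<^esub> \<alpha>"
proof -
  note X = is_relD(1)[OF r]
  note h = is_rel_h[OF X] and e = is_rel_cograph[OF T.is_map_eta[OF X]]
    and d = is_rel_cograph[OF S.is_map_eta[OF X]]
  have "cograph Q (eta T X) \<odot>\<^bsub>Q\<^esub> \<alpha> \<preceq>\<^bsub>Q\<^esub> (cograph Q (eta S X) \<odot>\<^bsub>Q\<^esub> h X) \<odot>\<^bsub>Q\<^esub> \<alpha>"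
    by (rule rel_comp_mono_left[OF h_unit[OF X] r e is_rel_comp[OF h d]])
  with u show ?thesis
    unfolding rel_comp_assoc[OF r h d]
    by (rule rel_le_trans[OF _ _ is_rel_cograph[OF is_map_id[OF X]] is_rel_comp[OF r e]
          is_rel_comp[OF is_rel_comp[OF r h] d]])
qed

text \<open>
  The facts \<open>1\<close> to \<open>4\<close> are the inequalities of the chain, the facts \<open>e1\<close> to \<open>e3\<close> the
  associativity steps that bring the next factor to be replaced together.
\<close>

lemma algebraic_functor_mult:
  assumes r: "is_rel X (fob T X) \<alpha>"
    and m: "That \<alpha> \<odot>\<^bsub>Q\<^esub> \<alpha> \<preceq>\<^bsub>Q\<^esub> cograph Q (mult T X) \<odot>\<^bsub>Q\<^esub> \<alpha>"
  shows "Shat (h X \<odot>\<^bsub>Q\<^esub> \<alpha>) \<odot>\<^bsub>Q\<^esub> h X \<odot>\<^bsub>Q\<^esub> \<alpha> \<preceq>\<^bsub>Q\<^esub> cograph Q (mult S X) \<odot>\<^bsub>Q\<^esub> h X \<odot>\<^bsub>Q\<^esub> \<alpha>"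
proof -
  note X = is_relD(1)[OF r] note TX = T.T_ob[OF X]
  note h = is_rel_h[OF X] and hT = is_rel_h[OF TX]
    and mT = is_rel_cograph[OF T.is_map_mult[OF X]] and mS = is_rel_cograph[OF S.is_map_mult[OF X]]
    and Sh = S.is_rel_That[OF is_rel_h[OF X]] and S\<alpha> = S.is_rel_That[OF r] and T\<alpha> = T.is_rel_That[OF r]
    and Sh\<alpha> = S.is_rel_That[OF is_rel_comp[OF r is_rel_h[OF X]]]
  note h\<alpha> = is_rel_comp[OF r h] and T\<alpha>\<alpha> = is_rel_comp[OF r T\<alpha>] and m\<alpha> = is_rel_comp[OF r mT]
    and ShhT = is_rel_comp[OF hT Sh] and hTm = is_rel_comp[OF mT hT] and S\<alpha>h = is_rel_comp[OF h S\<alpha>]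
    and hTT\<alpha> = is_rel_comp[OF T\<alpha> hT] and mSh = is_rel_comp[OF h mS]
  have 1: "Shat (h X \<odot>\<^bsub>Q\<^esub> \<alpha>) \<odot>\<^bsub>Q\<^esub> h X \<odot>\<^bsub>Q\<^esub> \<alpha> \<preceq>\<^bsub>Q\<^esub> (Shat (h X) \<odot>\<^bsub>Q\<^esub> Shat \<alpha>) \<odot>\<^bsub>Q\<^esub> h X \<odot>\<^bsub>Q\<^esub> \<alpha>"
    by (rule rel_comp_mono_left[OF h_comp[OF r] h\<alpha> Sh\<alpha> is_rel_comp[OF S\<alpha> Sh]])
  have e1: "(Shat (h X) \<odot>\<^bsub>Q\<^esub> Shat \<alpha>) \<odot>\<^bsub>Q\<^esub> h X \<odot>\<^bsub>Q\<^esub> \<alpha> = Shat (h X) \<odot>\<^bsub>Q\<^esub> (Shat \<alpha> \<odot>\<^bsub>Q\<^esub> h X) \<odot>\<^bsub>Q\<^esub> \<alpha>"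
    by (simp add: rel_comp_assoc[OF h\<alpha> S\<alpha> Sh] rel_comp_assoc[OF r h S\<alpha>])
  have "(Shat \<alpha> \<odot>\<^bsub>Q\<^esub> h X) \<odot>\<^bsub>Q\<^esub> \<alpha> \<preceq>\<^bsub>Q\<^esub> (h (fob T X) \<odot>\<^bsub>Q\<^esub> That \<alpha>) \<odot>\<^bsub>Q\<^esub> \<alpha>"
    by (rule rel_comp_mono_left[OF h_extension[OF r] r S\<alpha>h hTT\<alpha>])
  then have 2: "Shat (h X) \<odot>\<^bsub>Q\<^esub> (Shat \<alpha> \<odot>\<^bsub>Q\<^esub> h X) \<odot>\<^bsub>Q\<^esub> \<alpha> \<preceq>\<^bsub>Q\<^esub> Shat (h X) \<odot>\<^bsub>Q\<^esub> (h (fob T X) \<odot>\<^bsub>Q\<^esub> That \<alpha>) \<odot>\<^bsub>Q\<^esub> \<alpha>"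
    by (rule rel_comp_mono_right[OF _ is_rel_comp[OF r S\<alpha>h] is_rel_comp[OF r hTT\<alpha>] Sh])
  have e2: "Shat (h X) \<odot>\<^bsub>Q\<^esub> (h (fob T X) \<odot>\<^bsub>Q\<^esub> That \<alpha>) \<odot>\<^bsub>Q\<^esub> \<alpha> = (Shat (h X) \<odot>\<^bsub>Q\<^esub> h (fob T X)) \<odot>\<^bsub>Q\<^esub> That \<alpha> \<odot>\<^bsub>Q\<^esub> \<alpha>"
    by (simp add: rel_comp_assoc[OF r T\<alpha> hT] rel_comp_assoc[OF T\<alpha>\<alpha> hT Sh])
  have 3: "(Shat (h X) \<odot>\<^bsub>Q\<^esub> h (fob T X)) \<odot>\<^bsub>Q\<^esub> That \<alpha> \<odot>\<^bsub>Q\<^esub> \<alpha>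
      \<preceq>\<^bsub>Q\<^esub> (Shat (h X) \<odot>\<^bsub>Q\<^esub> h (fob T X)) \<odot>\<^bsub>Q\<^esub> cograph Q (mult T X) \<odot>\<^bsub>Q\<^esub> \<alpha>"
    by (rule rel_comp_mono_right[OF m T\<alpha>\<alpha> m\<alpha> ShhT])
  have e3: "(Shat (h X) \<odot>\<^bsub>Q\<^esub> h (fob T X)) \<odot>\<^bsub>Q\<^esub> cograph Q (mult T X) \<odot>\<^bsub>Q\<^esub> \<alpha>
      = (Shat (h X) \<odot>\<^bsub>Q\<^esub> h (fob T X) \<odot>\<^bsub>Q\<^esub> cograph Q (mult T X)) \<odot>\<^bsub>Q\<^esub> \<alpha>"
    by (simp add: rel_comp_assoc[OF r mT ShhT, symmetric] rel_comp_assoc[OF mT hT Sh])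
  have 4: "(Shat (h X) \<odot>\<^bsub>Q\<^esub> h (fob T X) \<odot>\<^bsub>Q\<^esub> cograph Q (mult T X)) \<odot>\<^bsub>Q\<^esub> \<alpha>
      \<preceq>\<^bsub>Q\<^esub> (cograph Q (mult S X) \<odot>\<^bsub>Q\<^esub> h X) \<odot>\<^bsub>Q\<^esub> \<alpha>"
    by (rule rel_comp_mono_left[OF h_mult[OF X] r is_rel_comp[OF hTm Sh] mSh])
  note t0 = is_rel_comp[OF h\<alpha> Sh\<alpha>] and t1 = is_rel_comp[OF is_rel_comp[OF r S\<alpha>h] Sh]
    and t2 = is_rel_comp[OF T\<alpha>\<alpha> ShhT] and t3 = is_rel_comp[OF r is_rel_comp[OF hTm Sh]]
    and t4 = is_rel_comp[OF r mSh]
  show ?thesis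
    using rel_le_trans[OF rel_le_trans[OF 1[unfolded e1] 2[unfolded e2] t0 t1 t2]
        rel_le_trans[OF 3[unfolded e3] 4 t2 t3 t4] t0 t2 t4]
    unfolding rel_comp_assoc[OF r h mS] .
qed

lemma algebraic_functor_Ob:
  "(X, \<alpha>) \<in> Ob (lax_cat Q T That) \<Longrightarrow> (X, h X \<odot>\<^bsub>Q\<^esub> \<alpha>) \<in> Ob (lax_cat Q S Shat)"
  using algebraic_functor_unit[of X \<alpha>] algebraic_functor_mult[of X \<alpha>] is_rel_comp[OF _ is_rel_h, of X X \<alpha>]
  by (auto simp: T.lax_cat_Ob_iff S.lax_cat_Ob_iff is_relD(1))

lemma algebraic_functor_Hom:
  assumes \<alpha>: "is_rel X (fob T X) \<alpha>" and \<beta>: "is_rel Y (fob T Y) \<beta>"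
    and f: "f \<in> Hom (lax_cat Q T That) (X, \<alpha>) (Y, \<beta>)"
  shows "f \<in> Hom (lax_cat Q S Shat) (X, h X \<odot>\<^bsub>Q\<^esub> \<alpha>) (Y, h Y \<odot>\<^bsub>Q\<^esub> \<beta>)"
proof -
  note X = is_relD(1)[OF \<alpha>] and Y = is_relD(1)[OF \<beta>]
  have m: "is_map X Y f" and le: "\<alpha> \<odot>\<^bsub>Q\<^esub> cograph Q f \<preceq>\<^bsub>Q\<^esub> cograph Q (fmap T f) \<odot>\<^bsub>Q\<^esub> \<beta>"
    using f X Y by (simp_all add: T.lax_cat_Hom_iff)
  note hX = is_rel_h[OF X] and hY = is_rel_h[OF Y] and c = is_rel_cograph[OF m]
    and cT = is_rel_cograph[OF T.is_map_fmap[OF m]] and cS = is_rel_cograph[OF S.is_map_fmap[OF m]]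
  note hXcT = is_rel_comp[OF cT hX] and cShY = is_rel_comp[OF hY cS]
  have 1: "h X \<odot>\<^bsub>Q\<^esub> \<alpha> \<odot>\<^bsub>Q\<^esub> cograph Q f \<preceq>\<^bsub>Q\<^esub> h X \<odot>\<^bsub>Q\<^esub> cograph Q (fmap T f) \<odot>\<^bsub>Q\<^esub> \<beta>"
    by (rule rel_comp_mono_right[OF le is_rel_comp[OF c \<alpha>] is_rel_comp[OF \<beta> cT] hX])
  have 2: "(h X \<odot>\<^bsub>Q\<^esub> cograph Q (fmap T f)) \<odot>\<^bsub>Q\<^esub> \<beta> \<preceq>\<^bsub>Q\<^esub> (cograph Q (fmap S f) \<odot>\<^bsub>Q\<^esub> h Y) \<odot>\<^bsub>Q\<^esub> \<beta>"
    by (rule rel_comp_mono_left[OF h_natural[OF m] \<beta> hXcT cShY])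
  have "(h X \<odot>\<^bsub>Q\<^esub> \<alpha>) \<odot>\<^bsub>Q\<^esub> cograph Q f \<preceq>\<^bsub>Q\<^esub> cograph Q (fmap S f) \<odot>\<^bsub>Q\<^esub> h Y \<odot>\<^bsub>Q\<^esub> \<beta>"
    using rel_le_trans[OF 1[folded rel_comp_assoc[OF c \<alpha> hX] rel_comp_assoc[OF \<beta> cT hX]] 2
        is_rel_comp[OF c is_rel_comp[OF \<alpha> hX]] is_rel_comp[OF \<beta> hXcT] is_rel_comp[OF \<beta> cShY]]
    unfolding rel_comp_assoc[OF \<beta> hY cS] .
  then show ?thesis
    using X Y m by (simp add: S.lax_cat_Hom_iff)
qed

lemma lax_algebraic_functor_is_functor:
  "is_functor (lax_cat Q T That) (lax_cat Q S Shat) (lax_algebraic_functor Q h)"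
  unfolding lax_algebraic_functor_def
proof (rule is_functor_identity_on_arrows[OF T.lax_cat_is_category S.lax_cat_is_category])
  show "(\<lambda>(X, \<alpha>). (X, h X \<odot>\<^bsub>Q\<^esub> \<alpha>)) a \<in> Ob (lax_cat Q S Shat)" if "a \<in> Ob (lax_cat Q T That)" for a
    using that algebraic_functor_Ob by (cases a) simp
  show "Hom (lax_cat Q T That) a b
      \<subseteq> Hom (lax_cat Q S Shat) ((\<lambda>(X, \<alpha>). (X, h X \<odot>\<^bsub>Q\<^esub> \<alpha>)) a) ((\<lambda>(X, \<alpha>). (X, h X \<odot>\<^bsub>Q\<^esub> \<alpha>)) b)"
    if "a \<in> Ob (lax_cat Q T That)" "b \<in> Ob (lax_cat Q T That)" for a b
    using that algebraic_functor_Hom by (cases a; cases b) (auto simp: T.lax_cat_Ob_iff)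
qed (auto simp: lax_cat_def)

text \<open>
  Each of the following conditions on \<open>tau\<close> has on both sides the mate of a composite relation, and
  these composites are the two sides of the corresponding condition on \<open>h\<close>.
\<close>

context
  fixes tau :: "'u slice_ob \<Rightarrow> 'u slice_map"
  assumes tau: "\<And>X. X \<in> slice_obs Q \<Longrightarrow> tau X = mate Q (h X)"
begin

lemma is_map_tau: "X \<in> slice_obs Q \<Longrightarrow> is_map (fob S X) (Pob Q (fob T X)) (tau X)"
  using is_map_mate[OF is_rel_h] tau by simp

lemma tau_natural:
  assumes f: "is_map X Y f"
  shows "Pmap Q (fmap T f) \<cdot> tau X \<lesssim>\<^bsub>Q,fob T Y\<^esub> tau Y \<cdot> fmap S f"
proof -
  note ob = is_mapD(1,2)[OF f]
  note Tf = T.is_map_fmap[OF f] and Sf = S.is_map_fmap[OF f]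
    and hX = is_rel_h[OF ob(1)] and hY = is_rel_h[OF ob(2)]
  show ?thesis
    using h_natural[OF f] unfolding tau[OF ob(1)] tau[OF ob(2)]
      mate_comp_cograph[OF Tf hX, symmetric] mate_cograph_comp[OF Sf hY, symmetric]
      mate_le_iff[OF is_rel_comp[OF is_rel_cograph[OF Tf] hX] is_rel_comp[OF hY is_rel_cograph[OF Sf]]] .
qed

lemma tau_unit:
  assumes X: "X \<in> slice_obs Q"
  shows "yon Q (fob T X) \<cdot> eta T X \<lesssim>\<^bsub>Q,fob T X\<^esub> tau X \<cdot> eta S X"
proof -
  note h = is_rel_h[OF X] and e = T.is_map_eta[OF X] and d = S.is_map_eta[OF X] and TX = T.T_ob[OF X]
  note i = is_rel_cograph[OF is_map_id[OF TX]]
  have "yon Q (fob T X) \<cdot> eta T X = mate Q (cograph Q (eta T X))"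
    unfolding mate_identity[OF TX, symmetric] mate_cograph_comp[OF e i, symmetric]
    by (simp add: comp_cograph_id[OF is_rel_cograph[OF e]])
  then show ?thesis
    using h_unit[OF X] mate_le_iff[OF is_rel_cograph[OF e] is_rel_comp[OF h is_rel_cograph[OF d]]]
    by (simp add: tau[OF X] mate_cograph_comp[OF d h])
qed

lemma tau_mult:
  assumes X: "X \<in> slice_obs Q"
  shows "Pmap Q (mult T X) \<cdot> psup Q (fob T (fob T X)) \<cdot> Pmap Q (tau (fob T X)) \<cdot> kap (fob T X)
      \<cdot> fmap S (tau X) \<lesssim>\<^bsub>Q,fob T X\<^esub> tau X \<cdot> mult S X"
proof -
  note TX = T.T_ob[OF X] note h = is_rel_h[OF X] and hT = is_rel_h[OF TX]
  note Sh = S.is_rel_That[OF h] and m = T.is_map_mult[OF X] and n = S.is_map_mult[OF X]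
  have l: "Pmap Q (mult T X) \<cdot> psup Q (fob T (fob T X)) \<cdot> Pmap Q (tau (fob T X)) \<cdot> kap (fob T X)
      \<cdot> fmap S (tau X) = mate Q (Shat (h X) \<odot>\<^bsub>Q\<^esub> h (fob T X) \<odot>\<^bsub>Q\<^esub> cograph Q (mult T X))"
    by (simp add: tau[OF X] tau[OF TX] S.mate_That[OF h, symmetric] mate_comp[OF hT Sh, symmetric]
        mate_comp_cograph[OF m is_rel_comp[OF hT Sh], symmetric]
        rel_comp_assoc[OF is_rel_cograph[OF m] hT Sh])
  have r: "tau X \<cdot> mult S X = mate Q (cograph Q (mult S X) \<odot>\<^bsub>Q\<^esub> h X)"
    by (simp add: tau[OF X] mate_cograph_comp[OF n h])
  show ?thesis
    unfolding l r
    using h_mult[OF X] mate_le_iff[OF is_rel_comp[OF is_rel_comp[OF is_rel_cograph[OF m] hT] Sh]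
        is_rel_comp[OF h is_rel_cograph[OF n]]] by simp
qed

text \<open>
  An arbitrary \<open>g\<close> is the mate of a relation \<open>\<phi>\<close>, for which the inequality is the compatibility
  of \<open>h\<close> with \<open>Shat \<phi>\<close> and \<open>That \<phi>\<close>.
\<close>

lemma tau_extension:
  assumes X: "X \<in> slice_obs Q" and g: "is_map Y (Pob Q X) g"
  shows "psup Q (fob T X) \<cdot> Pmap Q (tau X) \<cdot> kap X \<cdot> fmap S g
    \<lesssim>\<^bsub>Q,fob T X\<^esub> psup Q (fob T X) \<cdot> Pmap Q (lam X) \<cdot> Pmap Q (fmap T g) \<cdot> tau Y"
proof -
  obtain \<phi> where \<phi>: "is_rel X Y \<phi>" and g': "mate Q \<phi> = g"
    by (rule mate_surj[OF g X])
  note Y = is_mapD(1)[OF g]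
  note hX = is_rel_h[OF X] and hY = is_rel_h[OF Y]
    and S\<phi> = S.is_rel_That[OF \<phi>] and T\<phi> = T.is_rel_That[OF \<phi>]
  have l: "psup Q (fob T X) \<cdot> Pmap Q (tau X) \<cdot> kap X \<cdot> fmap S g = mate Q (Shat \<phi> \<odot>\<^bsub>Q\<^esub> h X)"
    by (simp add: tau[OF X] g'[symmetric] S.mate_That[OF \<phi>, symmetric] mate_comp[OF hX S\<phi>])
  note Tg = T.is_map_fmap[OF g] and lam = T.is_map_lam[OF X]
  have "mate Q (h Y \<odot>\<^bsub>Q\<^esub> That \<phi>)
      = psup Q (fob T X) \<cdot> (Pmap Q (lam X) \<cdot> Pmap Q (fmap T g)) \<cdot> tau Y"
    by (simp add: mate_comp[OF T\<phi> hY] T.mate_That[OF \<phi>] g' Pmap_comp[OF Tg lam] tau[OF Y])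
  then have r: "psup Q (fob T X) \<cdot> Pmap Q (lam X) \<cdot> Pmap Q (fmap T g) \<cdot> tau Y
      = mate Q (h Y \<odot>\<^bsub>Q\<^esub> That \<phi>)"
    by (simp add: map_comp_assoc[OF is_map_tau[OF Y] is_map_Pmap[OF Tg] is_map_Pmap[OF lam]])
  show ?thesis
    unfolding l r using h_extension[OF \<phi>] mate_le_iff[OF is_rel_comp[OF hX S\<phi>] is_rel_comp[OF T\<phi> hY]]
    by simp
qed

text \<open>
  Again \<open>p\<close> is the mate of some \<open>\<alpha>\<close>. By functoriality the left hand side is \<open>S\<close> applied to the
  mate of \<open>h X\<close> after \<open>\<alpha>\<close>, followed by \<open>kap X\<close>.
\<close>

lemma tau_comp:
  assumes X: "X \<in> slice_obs Q" and p: "is_map (fob T X) (Pob Q X) p"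
  shows "kap X \<cdot> fmap S (psup Q X) \<cdot> fmap S (Pmap Q p) \<cdot> fmap S (tau X)
    \<lesssim>\<^bsub>Q,fob S X\<^esub>
    psup Q (fob S X) \<cdot> Pmap Q (kap X) \<cdot> Pmap Q (fmap S p) \<cdot> kap (fob T X) \<cdot> fmap S (tau X)"
proof -
  obtain \<alpha> where \<alpha>: "is_rel X (fob T X) \<alpha>" and p': "mate Q \<alpha> = p"
    by (rule mate_surj[OF p X])
  note h = is_rel_h[OF X] note h\<alpha> = is_rel_comp[OF \<alpha> h]
  note Sh = S.is_rel_That[OF h] and S\<alpha> = S.is_rel_That[OF \<alpha>] and Sh\<alpha> = S.is_rel_That[OF h\<alpha>]
  note t = is_map_tau[OF X] and Pp = is_map_Pmap[OF p] and ps = is_map_psup[OF X]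
  note Sp = S.is_map_fmap[OF p] and kap = S.is_map_lam[OF X] and kapT = S.is_map_lam[OF T.T_ob[OF X]]
  have "mate Q (Shat (h X \<odot>\<^bsub>Q\<^esub> \<alpha>)) = kap X \<cdot> fmap S (psup Q X \<cdot> Pmap Q p \<cdot> tau X)"
    by (simp add: S.mate_That[OF h\<alpha>] mate_comp[OF \<alpha> h] p' tau[OF X])
  then have l: "kap X \<cdot> fmap S (psup Q X) \<cdot> fmap S (Pmap Q p) \<cdot> fmap S (tau X)
      = mate Q (Shat (h X \<odot>\<^bsub>Q\<^esub> \<alpha>))"
    by (simp add: S.fmap_comp[OF is_map_comp[OF t Pp] ps] S.fmap_comp[OF t Pp])
  have "mate Q (Shat (h X) \<odot>\<^bsub>Q\<^esub> Shat \<alpha>)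
      = psup Q (fob S X) \<cdot> (Pmap Q (kap X) \<cdot> Pmap Q (fmap S p)) \<cdot> kap (fob T X) \<cdot> fmap S (tau X)"
    by (simp add: mate_comp[OF S\<alpha> Sh] S.mate_That[OF \<alpha>] S.mate_That[OF h] p' tau[OF X]
        Pmap_comp[OF Sp kap])
  then have r: "psup Q (fob S X) \<cdot> Pmap Q (kap X) \<cdot> Pmap Q (fmap S p) \<cdot> kap (fob T X) \<cdot> fmap S (tau X)
      = mate Q (Shat (h X) \<odot>\<^bsub>Q\<^esub> Shat \<alpha>)"
    by (simp add: map_comp_assoc[OF is_map_comp[OF S.is_map_fmap[OF t] kapT]
          is_map_Pmap[OF Sp] is_map_Pmap[OF kap]])
  show ?thesis
    unfolding l r using h_comp[OF \<alpha>] mate_le_iff[OF Sh\<alpha> is_rel_comp[OF S\<alpha> Sh]] by simp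
qed

lemma dist_algebraic_morphism_tau: "dist_algebraic_morphism Q S kap T lam tau"
  unfolding dist_algebraic_morphism_def
  using is_mapD(5)[OF is_map_tau] tau_natural tau_unit tau_mult tau_extension tau_comp
  by (simp add: is_map_def T.T_ob Pob_in)

lemma algebraic_functors_agree:
  assumes "a \<in> Ob (lax_cat Q T That)"
  shows "(\<lambda>(X, p). (X, psup Q X \<cdot> Pmap Q p \<cdot> tau X)) ((\<lambda>(X, \<alpha>). (X, mate Q \<alpha>)) a)
    = (\<lambda>(X, \<alpha>). (X, mate Q \<alpha>)) ((\<lambda>(X, \<alpha>). (X, h X \<odot>\<^bsub>Q\<^esub> \<alpha>)) a)"
proof (cases a)
  case (Pair X \<alpha>)
  then have r: "is_rel X (fob T X) \<alpha>"
    using assms by (simp add: T.lax_cat_Ob_iff)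
  note X = is_relD(1)[OF r]
  show ?thesis
    by (simp add: Pair mate_comp[OF r is_rel_h[OF X]] tau[OF X])
qed

lemma dist_algebraic_functor_is_functor:
  "is_functor (dist_alg Q T lam) (dist_alg Q S kap) (dist_algebraic_functor Q tau)"
  unfolding dist_algebraic_functor_def
  by (rule is_functor_relabelling[OF T.mate_relabelling S.mate_relabelling
        lax_algebraic_functor_is_functor[unfolded lax_algebraic_functor_def] _ algebraic_functors_agree])
    (simp add: lax_cat_def)

lemma mate_of_lax_algebraic_functor:
  "functors_equal (lax_cat Q T That)
    (functor_comp (mate_functor Q) (lax_algebraic_functor Q h))
    (functor_comp (dist_algebraic_functor Q tau) (mate_functor Q))"
  using algebraic_functors_agree
  by (auto simp: functors_equal_def functor_comp_def mate_functor_def lax_algebraic_functor_def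
      dist_algebraic_functor_def)

end

end

theorem proposition7p1:
  fixes Q :: "('u::universe, 'u) quantaloid"
    and T S :: "'u slice_monad"
    and lam kap :: "'u slice_ob \<Rightarrow> 'u slice_map"
    and That Shat :: "'u qrel \<Rightarrow> 'u qrel"
    and h :: "'u slice_ob \<Rightarrow> 'u qrel"
    and tau :: "'u slice_ob \<Rightarrow> 'u slice_map"
  assumes "small_quantaloid Q"
    and "is_monad Q T" and "is_monad Q S"
    and "monotone_distributive_law Q T lam" and "monotone_distributive_law Q S kap"
    and "lax_extension Q T That" and "lax_extension Q S Shat"
    and "corresponding Q T lam That" and "corresponding Q S kap Shat"
    and "lax_algebraic_morphism Q T That S Shat h"
    and "\<And>X. X \<in> slice_obs Q \<Longrightarrow> tau X = mate Q (h X)"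
  shows "is_functor (lax_cat Q T That) (lax_cat Q S Shat) (lax_algebraic_functor Q h) \<and>
    dist_algebraic_morphism Q S kap T lam tau \<and>
    is_functor (dist_alg Q T lam) (dist_alg Q S kap) (dist_algebraic_functor Q tau) \<and>
    is_iso_functor (lax_cat Q T That) (dist_alg Q T lam) (mate_functor Q) \<and>
    is_iso_functor (lax_cat Q S Shat) (dist_alg Q S kap) (mate_functor Q) \<and>
    functors_equal (lax_cat Q T That)
      (functor_comp (mate_functor Q) (lax_algebraic_functor Q h))
      (functor_comp (dist_algebraic_functor Q tau) (mate_functor Q))"
proof -
  interpret algebraic_morphism Q T lam That S kap Shat h
    using assms by unfold_locales auto
  note tau = assms(11)
  show ?thesis
    using lax_algebraic_functor_is_functor dist_algebraic_morphism_tau[OF tau]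
      dist_algebraic_functor_is_functor[OF tau] T.mate_iso_functor S.mate_iso_functor
      mate_of_lax_algebraic_functor[OF tau]
    by blast
qed

end
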